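(* Let $k$ be an algebraically closed field with $\operatorname{char}k=0$ or $\operatorname{char}k\ge14$, let $W$ be the Albert algebra over $k$, and let $G$ be the simply connected group of type $E_6$ stabilising its determinant. Define, for operators $a_1a_2a_3,b_1b_2b_3\in\operatorname{End}(W)$ (with $a_i,b_i\in W$), $$a_1a_2a_3\odot_1b_1b_2b_3:=\sum_{\tau_a,\tau_b\in\mathcal S_3}\big((a_{\tau_a(1)}\times a_{\tau_a(2)})\times(b_{\tau_b(1)}\times b_{\tau_b(2)})\big)a_{\tau_a(3)}b_{\tau_b(3)}-\tfrac1{12}f'(a_1a_2a_3,b_1b_2b_3)\,\mathrm{id}_W .$$ Then $\odot_1$ (extended bilinearly, and restricted to $\sigma(V)$) is a well-defined commutative $G$-equivariant product on $\sigma(V)$.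
   Context: **Albert algebra.** $\mathbb O$ is the split octonion algebra over $k$: an $8$-dimensional unital algebra with unit $e$ and nondegenerate isotropic multiplicative quadratic form $N$; $\langle x,y\rangle=N(x+y)-N(x)-N(y)$, $\overline x=\langle x,e\rangle e-x$. $W=\mathcal H_3(\mathbb O)$ is the $27$-dimensional space of hermitian matrices $x=\begin{pmatrix}\alpha_1&c&\bar b\\ \bar c&\alpha_2&a\\ b&\bar a&\alpha_3\end{pmatrix}$ with Jordan product $x\cdot y=\tfrac12(xy+yx)$, trace form $\langle x,y\rangle=\operatorname{Tr}(x\cdot y)$, determinant $\det(x)=\alpha_1\alpha_2\alpha_3-\alpha_1N(a)-\alpha_2N(b)-\alpha_3N(c)+\langle(ab)c,e\rangle$, and symmetric trilinear form $\langle x,y,z\rangle$ with $\langle x,x,x\rangle=\det(x)$. The cross product is defined by $3\langle x,y,z\rangle=\langle x\times y,z\rangle$ for all $z\in W$. $G\subset\mathrm{GL}(W)$ is the stabiliser of $\det$; it acts on $\operatorname{End}(W)$ by conjugation. **Operators.** For $x,y,z\in W$, $xyz\in\operatorname{End}(W)$ denotes $w\mapsto\langle w,x,y\rangle z+\langle w,y,z\rangle x+\langle w,z,x\rangle y$; the summands in the definition of $\odot_1$ are operators of this form. $\sigma(A(G))=\operatorname{span}_k\{a_1a_2a_3\mid a_i\in W\}$ and $\sigma(V)$ is its subspace of trace-zero elements, i.e. $\{\sum_i a_ib_ic_i\mid\sum_i\langle a_i,b_i,c_i\rangle=0\}$ (irreducible of highest weight $\omega_1+\omega_6$). The form $f'$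 is the bilinear form given by $f'(a_1a_2a_3,b_1b_2b_3)=\sum_{\tau_a,\tau_b\in\mathcal S_3}\langle a_{\tau_a(1)},b_{\tau_b(2)},b_{\tau_b(3)}\rangle\langle b_{\tau_b(1)},a_{\tau_a(2)},a_{\tau_a(3)}\rangle$, which is well defined on $\sigma(A(G))$. *)

theory Defs
  imports
    "HOL-Analysis.Analysis"
    "HOL-Computational_Algebra.Computational_Algebra"
    "HOL-Library.Function_Algebras"
begin

section \<open>Split octonion algebras\<close>

text \<open>
  The additive group of the algebra is that of the type \<open>'o\<close>; the remaining structure is
  scalar multiplication, the (nonassociative) product, the unit and the quadratic form.
\<close>

record ('k, 'o) octonion_structure =
  osc :: "'k \<Rightarrow> 'o \<Rightarrow> 'o"
  omul :: "'o \<Rightarrow> 'o \<Rightarrow> 'o"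
  ounit :: "'o"
  onrm :: "'o \<Rightarrow> 'k"

definition opolar :: "('k::field, 'o::ab_group_add) octonion_structure \<Rightarrow> 'o \<Rightarrow> 'o \<Rightarrow> 'k" where
  "opolar Oc x y = onrm Oc (x + y) - onrm Oc x - onrm Oc y"

definition oconj :: "('k::field, 'o::ab_group_add) octonion_structure \<Rightarrow> 'o \<Rightarrow> 'o" where
  "oconj Oc x = osc Oc (opolar Oc x (ounit Oc)) (ounit Oc) - x"

locale split_octonion_algebra =
  fixes Oc :: "('k::field, 'o::ab_group_add) octonion_structure"
  assumes vector_space: "vector_space (osc Oc)"
    and dim_8: "vector_space.dim (osc Oc) (UNIV :: 'o set) = 8"
    and mul_linear_left: "\<And>y. Vector_Spaces.linear (osc Oc) (osc Oc) (\<lambda>x. omul Oc x y)"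
    and mul_linear_right: "\<And>x. Vector_Spaces.linear (osc Oc) (osc Oc) (\<lambda>y. omul Oc x y)"
    and unit_left: "\<And>x. omul Oc (ounit Oc) x = x"
    and unit_right: "\<And>x. omul Oc x (ounit Oc) = x"
    and nrm_scale: "\<And>c x. onrm Oc (osc Oc c x) = c\<^sup>2 * onrm Oc x"
    and polar_linear: "\<And>y. Vector_Spaces.linear (osc Oc) (*) (\<lambda>x. opolar Oc x y)"
    and nondegenerate: "\<And>x. (\<And>y. opolar Oc x y = 0) \<Longrightarrow> x = 0"
    and isotropic: "\<exists>x. x \<noteq> 0 \<and> onrm Oc x = 0"
    and multiplicative: "\<And>x y. onrm Oc (omul Oc x y) = onrm Oc x * onrm Oc y"

section \<open>The Albert algebra\<close>

text \<open>
  The tuple \<open>(\<alpha>\<^sub>1, \<alpha>\<^sub>2, \<alpha>\<^sub>3, a, b, c)\<close> stands for the hermitian matrix \<open>albert_matrix\<close> below,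
  where a scalar \<open>\<alpha>\<close> on the diagonal is identified with \<open>\<alpha>\<close> times the unit.
\<close>

type_synonym ('k, 'o) albert = "'k \<times> 'k \<times> 'k \<times> 'o \<times> 'o \<times> 'o"

fun wsc :: "('k::field, 'o::ab_group_add) octonion_structure \<Rightarrow> 'k \<Rightarrow> ('k, 'o) albert \<Rightarrow> ('k, 'o) albert" where
  "wsc Oc r (\<alpha>1, \<alpha>2, \<alpha>3, a, b, c)
    = (r * \<alpha>1, r * \<alpha>2, r * \<alpha>3, osc Oc r a, osc Oc r b, osc Oc r c)"

fun albert_matrix :: "('k::field, 'o::ab_group_add) octonion_structure \<Rightarrow> ('k, 'o) albert \<Rightarrow> 'o^3^3" where
  "albert_matrix Oc (\<alpha>1, \<alpha>2, \<alpha>3, a, b, c) = vector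
    [vector [osc Oc \<alpha>1 (ounit Oc), c, oconj Oc b],
     vector [oconj Oc c, osc Oc \<alpha>2 (ounit Oc), a],
     vector [b, oconj Oc a, osc Oc \<alpha>3 (ounit Oc)]]"

definition omatrix_mult :: "('k::field, 'o::ab_group_add) octonion_structure \<Rightarrow> 'o^3^3 \<Rightarrow> 'o^3^3 \<Rightarrow> 'o^3^3" where
  "omatrix_mult Oc X Y = (\<chi> i j. \<Sum>k\<in>UNIV. omul Oc (X $ i $ k) (Y $ k $ j))"

text \<open>
  \<open>albert_matrix\<close> is injective with image the hermitian matrices, and half the anticommutator
  of two hermitian matrices is hermitian, so the description below determines the Jordan product.
\<close>

definition jordan :: "('k::field, 'o::ab_group_add) octonion_structure
    \<Rightarrow> ('k, 'o) albert \<Rightarrow> ('k, 'o) albert \<Rightarrow> ('k, 'o) albert" where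
  "jordan Oc x y = (THE z. \<forall>i j. albert_matrix Oc z $ i $ j =
     osc Oc (1/2) ((omatrix_mult Oc (albert_matrix Oc x) (albert_matrix Oc y)
                  + omatrix_mult Oc (albert_matrix Oc y) (albert_matrix Oc x)) $ i $ j))"

fun albert_Tr :: "('k::field, 'o) albert \<Rightarrow> 'k" where
  "albert_Tr (\<alpha>1, \<alpha>2, \<alpha>3, a, b, c) = \<alpha>1 + \<alpha>2 + \<alpha>3"

definition trace_form :: "('k::field, 'o::ab_group_add) octonion_structure
    \<Rightarrow> ('k, 'o) albert \<Rightarrow> ('k, 'o) albert \<Rightarrow> 'k" where
  "trace_form Oc x y = albert_Tr (jordan Oc x y)"

fun albert_det :: "('k::field, 'o::ab_group_add) octonion_structure \<Rightarrow> ('k, 'o) albert \<Rightarrow> 'k" where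
  "albert_det Oc (\<alpha>1, \<alpha>2, \<alpha>3, a, b, c) =
     \<alpha>1 * \<alpha>2 * \<alpha>3 - \<alpha>1 * onrm Oc a - \<alpha>2 * onrm Oc b - \<alpha>3 * onrm Oc c
     + opolar Oc (omul Oc (omul Oc a b) c) (ounit Oc)"

text \<open>Symmetry is expressed by the two generating transpositions, so linearity in one slot suffices.\<close>

definition is_det_trilinear :: "('k::field, 'o::ab_group_add) octonion_structure
    \<Rightarrow> (('k, 'o) albert \<Rightarrow> ('k, 'o) albert \<Rightarrow> ('k, 'o) albert \<Rightarrow> 'k) \<Rightarrow> bool" where
  "is_det_trilinear Oc T \<longleftrightarrow>
     (\<forall>y z. Vector_Spaces.linear (wsc Oc) (*) (\<lambda>x. T x y z)) \<and>
     (\<forall>x y z. T x y z = T y x z \<and> T x y z = T x z y) \<and>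
     (\<forall>x. T x x x = albert_det Oc x)"

definition trilin :: "('k::field, 'o::ab_group_add) octonion_structure
    \<Rightarrow> ('k, 'o) albert \<Rightarrow> ('k, 'o) albert \<Rightarrow> ('k, 'o) albert \<Rightarrow> 'k" where
  "trilin Oc = (THE T. is_det_trilinear Oc T)"

definition cross :: "('k::field, 'o::ab_group_add) octonion_structure
    \<Rightarrow> ('k, 'o) albert \<Rightarrow> ('k, 'o) albert \<Rightarrow> ('k, 'o) albert" where
  "cross Oc x y = (THE u. \<forall>z. 3 * trilin Oc x y z = trace_form Oc u z)"

section \<open>The stabiliser of the determinant\<close>

definition det_stabiliser :: "('k::field, 'o::ab_group_add) octonion_structure
    \<Rightarrow> (('k, 'o) albert \<Rightarrow> ('k, 'o) albert) set" where
  "det_stabiliser Oc = {g. Vector_Spaces.linear (wsc Oc) (wsc Oc) g \<and> bij g \<and>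
     (\<forall>x. albert_det Oc (g x) = albert_det Oc x)}"

definition conjugate_by :: "('w \<Rightarrow> 'w) \<Rightarrow> ('w \<Rightarrow> 'w) \<Rightarrow> ('w \<Rightarrow> 'w)" where
  "conjugate_by g A = g \<circ> A \<circ> inv g"

section \<open>Operators\<close>

type_synonym ('k, 'o) albert_endo = "('k, 'o) albert \<Rightarrow> ('k, 'o) albert"

definition esc :: "('k::field, 'o::ab_group_add) octonion_structure
    \<Rightarrow> 'k \<Rightarrow> ('k, 'o) albert_endo \<Rightarrow> ('k, 'o) albert_endo" where
  "esc Oc r A = (\<lambda>w. wsc Oc r (A w))"

text \<open>The value does not depend on the basis; all bases of a finite-dimensional space are finite.\<close>

definition endo_trace :: "('k::field \<Rightarrow> 'w::ab_group_add \<Rightarrow> 'w) \<Rightarrow> ('w \<Rightarrow> 'w) \<Rightarrow> 'k" where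
  "endo_trace sc A =
     (let B = (SOME B. \<not> module.dependent sc B \<and> module.span sc B = UNIV)
      in \<Sum>b\<in>B. module.representation sc B (A b) b)"

definition triple_op :: "('k::field, 'o::ab_group_add) octonion_structure
    \<Rightarrow> ('k, 'o) albert \<Rightarrow> ('k, 'o) albert \<Rightarrow> ('k, 'o) albert \<Rightarrow> ('k, 'o) albert_endo" where
  "triple_op Oc x y z = (\<lambda>w. wsc Oc (trilin Oc w x y) z
     + wsc Oc (trilin Oc w y z) x + wsc Oc (trilin Oc w z x) y)"

definition sigma_A :: "('k::field, 'o::ab_group_add) octonion_structure \<Rightarrow> ('k, 'o) albert_endo set" where
  "sigma_A Oc = module.span (esc Oc) {triple_op Oc x y z | x y z. True}"

definition sigma_V :: "('k::field, 'o::ab_group_add) octonion_structure \<Rightarrow> ('k, 'o) albert_endo set" where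
  "sigma_V Oc = {A \<in> sigma_A Oc. endo_trace (wsc Oc) A = 0}"

text \<open>Bilinearity of a map on a subspace \<open>S\<close>; nothing is said about values outside \<open>S\<close>.\<close>

definition bilinear_on :: "('k \<Rightarrow> 'v::ab_group_add \<Rightarrow> 'v) \<Rightarrow> ('k \<Rightarrow> 'u::ab_group_add \<Rightarrow> 'u)
    \<Rightarrow> 'v set \<Rightarrow> ('v \<Rightarrow> 'v \<Rightarrow> 'u) \<Rightarrow> bool" where
  "bilinear_on s1 s2 S P \<longleftrightarrow>
     (\<forall>A\<in>S. \<forall>B\<in>S. \<forall>C\<in>S. P (A + B) C = P A C + P B C \<and> P C (A + B) = P C A + P C B) \<and>
     (\<forall>r. \<forall>A\<in>S. \<forall>B\<in>S. P (s1 r A) B = s2 r (P A B) \<and> P A (s1 r B) = s2 r (P A B))"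

text \<open>
  Triples \<open>(a\<^sub>1, a\<^sub>2, a\<^sub>3)\<close> are functions on the three-element type \<open>3\<close>
  (whose elements are 1, 2 and 3 = 0).
\<close>

abbreviation triple_op3 :: "('k::field, 'o::ab_group_add) octonion_structure
    \<Rightarrow> (3 \<Rightarrow> ('k, 'o) albert) \<Rightarrow> ('k, 'o) albert_endo" where
  "triple_op3 Oc a \<equiv> triple_op Oc (a 1) (a 2) (a 3)"

abbreviation S3 :: "(3 \<Rightarrow> 3) set" where
  "S3 \<equiv> {\<tau>. \<tau> permutes UNIV}"

definition is_f' :: "('k::field, 'o::ab_group_add) octonion_structure
    \<Rightarrow> (('k, 'o) albert_endo \<Rightarrow> ('k, 'o) albert_endo \<Rightarrow> 'k) \<Rightarrow> bool" where
  "is_f' Oc f \<longleftrightarrow> bilinear_on (esc Oc) (*) (sigma_A Oc) f \<and>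
     (\<forall>a b. f (triple_op3 Oc a) (triple_op3 Oc b) =
        (\<Sum>\<tau>a\<in>S3. \<Sum>\<tau>b\<in>S3. trilin Oc (a (\<tau>a 1)) (b (\<tau>b 2)) (b (\<tau>b 3))
                              * trilin Oc (b (\<tau>b 1)) (a (\<tau>a 2)) (a (\<tau>a 3))))"

text \<open>A form satisfying \<open>is_f'\<close> exists, and its values on \<open>sigma_A\<close>, the only ones used, are unique.\<close>

definition f' :: "('k::field, 'o::ab_group_add) octonion_structure
    \<Rightarrow> ('k, 'o) albert_endo \<Rightarrow> ('k, 'o) albert_endo \<Rightarrow> 'k" where
  "f' Oc = (SOME f. is_f' Oc f)"

definition is_odot1 :: "('k::field, 'o::ab_group_add) octonion_structure
    \<Rightarrow> (('k, 'o) albert_endo \<Rightarrow> ('k, 'o) albert_endo \<Rightarrow> ('k, 'o) albert_endo) \<Rightarrow> bool" where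
  "is_odot1 Oc P \<longleftrightarrow> bilinear_on (esc Oc) (esc Oc) (sigma_A Oc) P \<and>
     (\<forall>a b. P (triple_op3 Oc a) (triple_op3 Oc b) =
        (\<Sum>\<tau>a\<in>S3. \<Sum>\<tau>b\<in>S3.
           triple_op Oc
             (cross Oc (cross Oc (a (\<tau>a 1)) (a (\<tau>a 2))) (cross Oc (b (\<tau>b 1)) (b (\<tau>b 2))))
             (a (\<tau>a 3)) (b (\<tau>b 3)))
        - esc Oc (1/12 * f' Oc (triple_op3 Oc a) (triple_op3 Oc b)) id)"

end

theory Submission
  imports Defs
begin

text \<open>
  For a cube, \<open>aaa\<close> is the rank one operator \<open>w \<mapsto> \<langle>a \<times> a, w\<rangle> a\<close>, and by polarisation cubes
  span \<open>\<sigma>(A(G))\<close>. Write \<open>p \<otimes> a\<close> for \<open>w \<mapsto> \<langle>p, w\<rangle> a\<close>. The sum defining the product on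
  \<open>a\<^sub>1a\<^sub>2a\<^sub>3\<close> and \<open>b\<^sub>1b\<^sub>2b\<^sub>3\<close> is \<open>36 \<Phi>\<close> for the bilinear map \<open>\<Phi>\<close> on all of \<open>End(W)\<close> with
  \<open>\<Phi>(p \<otimes> a, q \<otimes> b) = (p \<times> q)ab\<close>, and \<open>f'(A, B) = 4 tr(AB)\<close>; this gives well-definedness.
  Linearising \<open>(x \<times> x) \<times> (x \<times> x) = det(x) x\<close> gives
  \<open>4 (x \<times> x) \<times> (x \<times> y) = det(x) y + \<langle>x \<times> x, y\<rangle> x\<close>, hence
  \<open>12 tr \<Phi>(A, B) = tr(A) tr(B) + 3 tr(AB)\<close> on \<open>\<sigma>(A(G))\<close>. As \<open>tr id = 27\<close>, the correction
  term makes the product traceless on \<open>\<sigma>(V)\<close>. Equivariance holds because the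
  contragredient \<open>h\<close> of \<open>g\<close> satisfies \<open>gx \<times> gy = h(x \<times> y)\<close> and \<open>hp \<times> hq = g(p \<times> q)\<close>.
\<close>

section \<open>Dual bases, quartics and sums over permutations\<close>

text \<open>By nondegeneracy the linear map \<open>L\<close>, whose coordinates are the values
  \<open>f v b\<close>, is injective, hence surjective in finite dimension; preimages of the basis
  vectors form the dual basis. The form may be asymmetric, as is the trace form twisted by a group
  element later on.\<close>

lemma (in vector_space) dual_basis_exists:
  assumes B: "finite B" "independent B" "span B = UNIV"
    and add: "\<And>x y z. f (x + y) z = f x z + f y z" "\<And>x y z. f z (x + y) = f z x + f z y"
    and scale: "\<And>r x z. f (scale r x) z = r * f x z" "\<And>r x z. f z (scale r x) = r * f z x"
    and nondeg: "\<And>x. (\<And>y. f x y = 0) \<Longrightarrow> x = 0"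
  shows "\<exists>d. \<forall>b\<in>B. \<forall>v. f (d b) v = representation B v b"
proof -
  interpret fd: finite_dimensional_vector_space scale B
    by unfold_locales (use B in auto)
  define L where "L v = (\<Sum>b\<in>B. scale (f v b) b)" for v
  have lin: "Vector_Spaces.linear scale scale L"
    unfolding Vector_Spaces.linear_iff
    by (simp add: L_def add scale scale_left_distrib sum.distrib scale_sum_right vector_space_axioms)
  have rep: "representation B (L v) b = f v b" if "b \<in> B" for v b
    unfolding L_def using that B by (simp add: representation_sum representation_scale
        representation_basis span_base span_scale if_distrib cong: if_cong)
  have sum_f: "f v (\<Sum>b\<in>S. g b) = (\<Sum>b\<in>S. f v (g b))" for v g and S :: "'b set"
  proof (induction S rule: infinite_finite_induct)
    case empty
    then show ?case using scale(2)[of v 0 0] by simp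
  next
    case (infinite S)
    then show ?case using scale(2)[of v 0 0] by simp
  qed (simp_all add: add)
  have expand: "f v w = (\<Sum>b\<in>B. representation B w b * f v b)" for v w
  proof -
    have "w = (\<Sum>b\<in>B. scale (representation B w b) b)"
      using B by (simp add: sum_representation_eq)
    then have "f v w = f v (\<Sum>b\<in>B. scale (representation B w b) b)" by simp
    then show ?thesis by (simp only: sum_f scale)
  qed
  have fdiff: "f (x - y) z = f x z - f y z" for x y z
    using add(1)[of "x - y" y z] by simp
  have "inj L"
  proof (rule injI)
    fix x y assume "L x = L y"
    then have "L (x - y) = 0"
      by (simp add: L_def sum_subtractf scale_left_diff_distrib fdiff)
    then have "f (x - y) b = 0" if "b \<in> B" for b
      using rep[OF that, of "x - y"] by (simp add: representation_zero)
    then have "f (x - y) w = 0" for w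
      by (subst expand) simp
    then have "x - y = 0"
      by (rule nondeg)
    then show "x = y"
      by simp
  qed
  then have "surj L"
    using fd.linear_inj_imp_surj[OF lin] by simp
  then obtain d where d: "L (d b) = b" for b
    by (metis surj_def)
  have "f (d b) v = representation B v b" if "b \<in> B" for b v
  proof -
    have "f (d b) c = (if c = b then 1 else 0)" if "c \<in> B" for c
      using rep[OF that, of "d b"] representation_basis[OF B(2) \<open>b \<in> B\<close>] by (simp add: d)
    then have "f (d b) v = (\<Sum>c\<in>B. if c = b then representation B v b else 0)"
      by (subst expand) (auto intro!: sum.cong)
    then show ?thesis
      using that B by simp
  qed
  then show ?thesis by blast
qed

text \<open>The values at 0, 1, -1, 2, -2 already determine the coefficients, and the elimination
  divides only by 2 and 3.\<close>

lemma quartic_coefficients: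
  fixes c0 c1 c2 c3 c4 :: "'a::field"
  assumes two: "(2::'a) \<noteq> 0" and three: "(3::'a) \<noteq> 0"
    and 0: "\<And>t. c0 + t * c1 + t^2 * c2 + t^3 * c3 + t^4 * c4 = 0"
  shows "c1 = 0" "c2 = 0"
proof -
  have eqs: "c0 = 0" "c0 + c1 + c2 + c3 + c4 = 0" "c0 - c1 + c2 - c3 + c4 = 0"
    "c0 + 2 * c1 + 4 * c2 + 8 * c3 + 16 * c4 = 0" "c0 - 2 * c1 + 4 * c2 - 8 * c3 + 16 * c4 = 0"
    using 0[of 0] 0[of 1] 0[of "- 1"] 0[of 2] 0[of "- 2"] by (simp_all add: algebra_simps)
  \<comment> \<open>The odd parts at 1 and 2 eliminate \<open>c3\<close> and leave
    \<open>12 * c1\<close>; the even parts eliminate \<open>c4\<close> and leave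
    \<open>24 * c2\<close>. Both constants are factored into 2 and 3 to apply the
    assumptions.\<close>
  have "2 * (2 * (3 * c1)) = 8 * ((c0 + c1 + c2 + c3 + c4) - (c0 - c1 + c2 - c3 + c4))
    - ((c0 + 2 * c1 + 4 * c2 + 8 * c3 + 16 * c4) - (c0 - 2 * c1 + 4 * c2 - 8 * c3 + 16 * c4))"
    by (simp add: algebra_simps)
  moreover have "2 * (2 * (2 * (3 * c2))) = 16 * ((c0 + c1 + c2 + c3 + c4) + (c0 - c1 + c2 - c3 + c4))
    - ((c0 + 2 * c1 + 4 * c2 + 8 * c3 + 16 * c4) + (c0 - 2 * c1 + 4 * c2 - 8 * c3 + 16 * c4)) - 30 * c0"
    by (simp add: algebra_simps)
  ultimately have "2 * (2 * (3 * c1)) = 0" "2 * (2 * (2 * (3 * c2))) = 0"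
    by (simp_all only: eqs(2-5)) (simp_all add: eqs(1))
  with two three show "c1 = 0" "c2 = 0"
    by (simp_all only: mult_eq_0_iff) auto
qed

lemma S3_sum:
  fixes f :: "3 \<Rightarrow> 3 \<Rightarrow> 3 \<Rightarrow> 'a::comm_monoid_add"
  shows "(\<Sum>\<tau>\<in>S3. f (\<tau> 1) (\<tau> 2) (\<tau> 3)) = f 1 2 3 + f 1 3 2 + f 2 1 3 + f 2 3 1 + f 3 1 2 + f 3 2 1"
proof -
  have f123: "finite {2::3, 3}" "1 \<notin> {2::3, 3}"
    by auto
  have f23: "finite {3::3}" "2 \<notin> {3::3}"
    by auto
  show ?thesis
    unfolding UNIV_3
    unfolding sum_over_permutations_insert[OF f123]
    unfolding sum_over_permutations_insert[OF f23]
    unfolding permutes_sing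
    by (simp add: transpose_def add_ac)
qed

text \<open>The symmetry folds the six permutations onto the three cyclic ones. The factor two stays
  a repeated sum, so that the lemma serves scalars and operators alike.\<close>

lemma S3_sum_symmetric_12:
  fixes f :: "3 \<Rightarrow> 3 \<Rightarrow> 3 \<Rightarrow> 'a::comm_monoid_add"
  assumes "\<And>i j k. f i j k = f j i k"
  shows "(\<Sum>\<tau>\<in>S3. f (\<tau> 1) (\<tau> 2) (\<tau> 3)) = (f 1 2 3 + f 2 3 1 + f 3 1 2) + (f 1 2 3 + f 2 3 1 + f 3 1 2)"
  unfolding S3_sum[of f] assms[of 1 3 2] assms[of 2 1 3] assms[of 3 2 1] by (simp only: ac_simps)

lemma S3_sum_symmetric_23:
  fixes f :: "3 \<Rightarrow> 3 \<Rightarrow> 3 \<Rightarrow> 'a::comm_monoid_add"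
  assumes "\<And>i j k. f i j k = f i k j"
  shows "(\<Sum>\<tau>\<in>S3. f (\<tau> 1) (\<tau> 2) (\<tau> 3)) = (f 1 2 3 + f 2 3 1 + f 3 1 2) + (f 1 2 3 + f 2 3 1 + f 3 1 2)"
  unfolding S3_sum[of f] assms[of 1 3 2] assms[of 2 1 3] assms[of 3 2 1] by (simp only: ac_simps)

section \<open>Octonions\<close>

text \<open>The assumption on the characteristic enters as invertibility of 2 and 3: halves for the
  Jordan product, sixths for polarising a cubic form.\<close>

locale octonions = split_octonion_algebra Oc
  for Oc :: "('k::field, 'o::ab_group_add) octonion_structure" +
  assumes two: "(2::'k) \<noteq> 0" and three: "(3::'k) \<noteq> 0"
begin

sublocale O: vector_space "osc Oc"
  by (rule vector_space)

abbreviation scale_O (infixr "*\<^sub>O" 75) where "scale_O \<equiv> osc Oc"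
abbreviation mult_O (infixl "\<cdot>" 70) where "mult_O \<equiv> omul Oc"
abbreviation unit_O ("\<e>") where "unit_O \<equiv> ounit Oc"
abbreviation norm_O ("\<N>") where "norm_O \<equiv> onrm Oc"
abbreviation polar_O ("\<langle>_, _\<rangle>") where "polar_O \<equiv> opolar Oc"
abbreviation conj_O ("\<kappa>") where "conj_O \<equiv> oconj Oc"

lemma mult_distribs:
  "(x + y) \<cdot> z = x \<cdot> z + y \<cdot> z" "z \<cdot> (x + y) = z \<cdot> x + z \<cdot> y"
  "(r *\<^sub>O x) \<cdot> z = r *\<^sub>O (x \<cdot> z)" "z \<cdot> (r *\<^sub>O x) = r *\<^sub>O (z \<cdot> x)"
  using mul_linear_left[of z] mul_linear_right[of z]
  by (simp_all add: Vector_Spaces.linear_iff)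

lemma mult_zero [simp]: "0 \<cdot> z = 0" "z \<cdot> 0 = 0"
  using mult_distribs(1)[of 0 0 z] mult_distribs(2)[of z 0 0] by simp_all

lemma mult_minus [simp]: "(- x) \<cdot> z = - (x \<cdot> z)" "z \<cdot> (- x) = - (z \<cdot> x)"
  using mult_distribs(1)[of x "- x" z] mult_distribs(2)[of z x "- x"]
  by (simp_all add: eq_neg_iff_add_eq_0 add.commute)

lemma mult_diff: "(x - y) \<cdot> z = x \<cdot> z - y \<cdot> z" "z \<cdot> (x - y) = z \<cdot> x - z \<cdot> y"
  using mult_distribs(1)[of x "- y" z] mult_distribs(2)[of z x "- y"] by simp_all

lemma polar_commute: "\<langle>x, y\<rangle> = \<langle>y, x\<rangle>"
  by (simp add: opolar_def add.commute)

lemma polar_distribs: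
  "\<langle>x + y, z\<rangle> = \<langle>x, z\<rangle> + \<langle>y, z\<rangle>" "\<langle>z, x + y\<rangle> = \<langle>z, x\<rangle> + \<langle>z, y\<rangle>"
  "\<langle>r *\<^sub>O x, z\<rangle> = r * \<langle>x, z\<rangle>" "\<langle>z, r *\<^sub>O x\<rangle> = r * \<langle>z, x\<rangle>"
  using polar_linear[of z] polar_commute[of z]
  by (simp_all add: Vector_Spaces.linear_iff)

lemma polar_zero [simp]: "\<langle>0, z\<rangle> = 0" "\<langle>z, 0\<rangle> = 0"
  using polar_distribs(3)[of 0 0 z] polar_distribs(4)[of z 0 0] by simp_all

lemma polar_minus [simp]: "\<langle>- x, z\<rangle> = - \<langle>x, z\<rangle>" "\<langle>z, - x\<rangle> = - \<langle>z, x\<rangle>"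
  using polar_distribs(1)[of x "- x" z] polar_distribs(2)[of z x "- x"]
  by (simp_all add: eq_neg_iff_add_eq_0 add.commute)

lemma polar_diff: "\<langle>x - y, z\<rangle> = \<langle>x, z\<rangle> - \<langle>y, z\<rangle>" "\<langle>z, x - y\<rangle> = \<langle>z, x\<rangle> - \<langle>z, y\<rangle>"
  using polar_distribs(1)[of x "- y" z] polar_distribs(2)[of z x "- y"] by simp_all

lemma polar_sum: "\<langle>\<Sum>i\<in>I. f i, z\<rangle> = (\<Sum>i\<in>I. \<langle>f i, z\<rangle>)"
  by (induction I rule: infinite_finite_induct) (simp_all add: polar_distribs)

lemma eq_by_polar: "(\<And>z. \<langle>x, z\<rangle> = \<langle>y, z\<rangle>) \<Longrightarrow> x = y"
  using nondegenerate[of "x - y"] by (simp add: polar_diff)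

lemma norm_add: "\<N> (x + y) = \<N> x + \<N> y + \<langle>x, y\<rangle>"
  by (simp add: opolar_def)

lemma norm_minus [simp]: "\<N> (- x) = \<N> x"
  using nrm_scale[of "- 1" x] by simp

lemma norm_diff: "\<N> (x - y) = \<N> x + \<N> y - \<langle>x, y\<rangle>"
  using norm_add[of x "- y"] by simp

lemma norm_zero [simp]: "\<N> 0 = 0"
  using nrm_scale[of 0 0] by simp

lemma polar_self: "\<langle>x, x\<rangle> = 2 * \<N> x"
  using norm_add[of x x] nrm_scale[of 2 x] O.scale_left_distrib[of 1 1 x]
  by (simp add: power2_eq_square one_add_one)

text \<open>From \<open>\<N> x = \<N> \<e> * \<N> x\<close>, any other value of
  \<open>\<N> \<e>\<close> makes the norm vanish identically, so by nondegeneracy the whole algebra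
  is zero.\<close>

lemma norm_unit [simp]: "\<N> \<e> = 1"
proof (rule ccontr)
  assume "\<N> \<e> \<noteq> 1"
  then have 0: "\<N> x = 0" for x
    using multiplicative[of \<e> x] by (simp add: unit_left)
  have "x = 0" for x :: 'o
    by (rule nondegenerate) (simp add: opolar_def 0)
  then show False
    using isotropic by blast
qed

lemma unit_nonzero [simp]: "\<e> \<noteq> 0"
  using norm_unit by force

section \<open>Composition algebra identities\<close>

lemma polar_mult_same: "\<langle>x \<cdot> y, x \<cdot> z\<rangle> = \<N> x * \<langle>y, z\<rangle>" "\<langle>y \<cdot> x, z \<cdot> x\<rangle> = \<langle>y, z\<rangle> * \<N> x"
  by (simp_all add: opolar_def mult_distribs[symmetric] multiplicative algebra_simps)

text \<open>Multiplicativity linearised in both factors. Together with the adjointness relations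
  that follow from it, this does the work of the missing associativity.\<close>

lemma polar_mult_mult: "\<langle>x \<cdot> y, z \<cdot> w\<rangle> + \<langle>x \<cdot> w, z \<cdot> y\<rangle> = \<langle>x, z\<rangle> * \<langle>y, w\<rangle>"
proof -
  have "\<langle>(x + z) \<cdot> y, (x + z) \<cdot> w\<rangle> = \<N> (x + z) * \<langle>y, w\<rangle>"
    by (rule polar_mult_same)
  then show ?thesis
    by (simp add: mult_distribs polar_distribs norm_add polar_mult_same polar_commute algebra_simps)
qed

lemma conj_distribs: "\<kappa> (x + y) = \<kappa> x + \<kappa> y" "\<kappa> (x - y) = \<kappa> x - \<kappa> y" "\<kappa> (r *\<^sub>O x) = r *\<^sub>O \<kappa> x"
  "\<kappa> (- x) = - \<kappa> x" "\<kappa> 0 = 0"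
  by (simp_all add: oconj_def polar_distribs polar_diff O.scale_left_distrib
      O.scale_left_diff_distrib O.scale_right_diff_distrib algebra_simps)

lemma conj_unit [simp]: "\<kappa> \<e> = \<e>"
proof -
  have "\<langle>\<e>, \<e>\<rangle> *\<^sub>O \<e> = \<e> + \<e>"
    using O.scale_left_distrib[of 1 1 \<e>] by (simp add: polar_self one_add_one)
  then show ?thesis by (simp add: oconj_def)
qed

lemma conj_conj [simp]: "\<kappa> (\<kappa> x) = x"
  by (subst (2) oconj_def) (simp only: conj_distribs conj_unit, simp add: oconj_def)

lemma polar_conj_unit: "\<langle>\<kappa> x, \<e>\<rangle> = \<langle>x, \<e>\<rangle>"
  by (simp add: oconj_def polar_diff polar_distribs polar_self)

text \<open>The doubly linearised norm identity with one slot equal to the unit: the correction term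
  it produces is exactly what conjugation absorbs.\<close>

lemma polar_conj_left: "\<langle>x \<cdot> y, z\<rangle> = \<langle>y, \<kappa> x \<cdot> z\<rangle>"
  using polar_mult_mult[of x y \<e> z] polar_commute[of "x \<cdot> z" y]
  by (simp add: oconj_def mult_diff mult_distribs polar_diff polar_distribs unit_left algebra_simps)

lemma polar_conj_right: "\<langle>x \<cdot> y, z\<rangle> = \<langle>x, z \<cdot> \<kappa> y\<rangle>"
  using polar_mult_mult[of x y z \<e>]
  by (simp add: oconj_def mult_diff mult_distribs polar_diff polar_distribs unit_right algebra_simps)

lemma polar_conj_conj: "\<langle>\<kappa> x, \<kappa> y\<rangle> = \<langle>x, y\<rangle>"
  by (simp add: oconj_def polar_diff polar_distribs polar_self polar_commute algebra_simps)

lemma conj_mult: "\<kappa> (x \<cdot> y) = \<kappa> y \<cdot> \<kappa> x"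
proof (rule eq_by_polar)
  fix z
  have "\<langle>\<kappa> (x \<cdot> y), z\<rangle> = \<langle>x \<cdot> y, \<kappa> z\<rangle>"
    using polar_conj_conj[of "x \<cdot> y" "\<kappa> z"] by simp
  also have "\<dots> = \<langle>\<kappa> z \<cdot> \<kappa> y, x\<rangle>"
    using polar_conj_right[of x y "\<kappa> z"] polar_commute[of "\<kappa> z \<cdot> \<kappa> y" x] by simp
  also have "\<dots> = \<langle>\<kappa> y, z \<cdot> x\<rangle>"
    by (simp add: polar_conj_left)
  also have "\<dots> = \<langle>\<kappa> y \<cdot> \<kappa> x, z\<rangle>"
    by (simp add: polar_conj_right)
  finally show "\<langle>\<kappa> (x \<cdot> y), z\<rangle> = \<langle>\<kappa> y \<cdot> \<kappa> x, z\<rangle>" .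
qed

lemma norm_conj [simp]: "\<N> (\<kappa> x) = \<N> x"
  using polar_conj_conj[of x x] two by (simp add: polar_self)

lemma conj_cancel_left: "\<kappa> x \<cdot> (x \<cdot> y) = \<N> x *\<^sub>O y"
proof (rule eq_by_polar)
  fix z
  have "\<langle>\<kappa> x \<cdot> (x \<cdot> y), z\<rangle> = \<langle>x \<cdot> y, x \<cdot> z\<rangle>"
    using polar_conj_left[of "\<kappa> x" "x \<cdot> y" z] by simp
  then show "\<langle>\<kappa> x \<cdot> (x \<cdot> y), z\<rangle> = \<langle>\<N> x *\<^sub>O y, z\<rangle>"
    by (simp add: polar_mult_same polar_distribs)
qed

lemma conj_cancel_right: "(y \<cdot> x) \<cdot> \<kappa> x = \<N> x *\<^sub>O y"
proof (rule eq_by_polar)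
  fix z
  have "\<langle>(y \<cdot> x) \<cdot> \<kappa> x, z\<rangle> = \<langle>y \<cdot> x, z \<cdot> x\<rangle>"
    using polar_conj_right[of "y \<cdot> x" "\<kappa> x" z] by simp
  then show "\<langle>(y \<cdot> x) \<cdot> \<kappa> x, z\<rangle> = \<langle>\<N> x *\<^sub>O y, z\<rangle>"
    by (simp add: polar_mult_same polar_distribs)
qed

lemma conj_mult_polarized: "x \<cdot> \<kappa> y + y \<cdot> \<kappa> x = \<langle>x, y\<rangle> *\<^sub>O \<e>" "\<kappa> x \<cdot> y + \<kappa> y \<cdot> x = \<langle>x, y\<rangle> *\<^sub>O \<e>"
proof -
  have 1: "u \<cdot> \<kappa> u = \<N> u *\<^sub>O \<e>" "\<kappa> u \<cdot> u = \<N> u *\<^sub>O \<e>" for u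
    using conj_cancel_right[of \<e> u] conj_cancel_left[of u \<e>] by (simp_all add: unit_left unit_right)
  show "x \<cdot> \<kappa> y + y \<cdot> \<kappa> x = \<langle>x, y\<rangle> *\<^sub>O \<e>" "\<kappa> x \<cdot> y + \<kappa> y \<cdot> x = \<langle>x, y\<rangle> *\<^sub>O \<e>"
    using 1[of "x + y"] 1[of x] 1[of y]
    by (simp_all add: conj_distribs mult_distribs norm_add O.scale_left_distrib algebra_simps)
qed

text \<open>The Moufang identity \<open>(ax)(ya) = a(xy)a\<close>, with the right side expanded by
  \<open>aua = \<langle>\<kappa> u, a\<rangle>a - \<N>(a) \<kappa> u\<close>. After pairing with
  \<open>z\<close>, \<open>polar_mult_mult\<close> exchanges \<open>a\<close> and \<open>z\<close>,
  which brings \<open>a\<close> next to its conjugate.\<close>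

lemma moufang: "(a \<cdot> x) \<cdot> (y \<cdot> a) = \<langle>\<kappa> (x \<cdot> y), a\<rangle> *\<^sub>O a - \<N> a *\<^sub>O \<kappa> (x \<cdot> y)"
proof (rule eq_by_polar)
  fix z
  have "\<langle>(a \<cdot> x) \<cdot> (y \<cdot> a), z\<rangle> = \<langle>y \<cdot> a, (\<kappa> x \<cdot> \<kappa> a) \<cdot> z\<rangle>"
    by (simp add: polar_conj_left conj_mult)
  also have "\<dots> = \<langle>y, \<kappa> x \<cdot> \<kappa> a\<rangle> * \<langle>a, z\<rangle> - \<langle>y \<cdot> z, (\<kappa> x \<cdot> \<kappa> a) \<cdot> a\<rangle>"
    using polar_mult_mult[of y a "\<kappa> x \<cdot> \<kappa> a" z] by (simp add: algebra_simps)
  also have "(\<kappa> x \<cdot> \<kappa> a) \<cdot> a = \<N> a *\<^sub>O \<kappa> x"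
    using conj_cancel_right[of "\<kappa> x" "\<kappa> a"] by simp
  also have "\<langle>y, \<kappa> x \<cdot> \<kappa> a\<rangle> = \<langle>\<kappa> (x \<cdot> y), a\<rangle>"
    by (metis conj_conj polar_commute polar_conj_conj polar_conj_left)
  also have "\<langle>y \<cdot> z, \<N> a *\<^sub>O \<kappa> x\<rangle> = \<N> a * \<langle>\<kappa> (x \<cdot> y), z\<rangle>"
    unfolding conj_mult polar_distribs
    by (metis polar_commute polar_conj_left polar_conj_right)
  finally show "\<langle>(a \<cdot> x) \<cdot> (y \<cdot> a), z\<rangle> = \<langle>\<langle>\<kappa> (x \<cdot> y), a\<rangle> *\<^sub>O a - \<N> a *\<^sub>O \<kappa> (x \<cdot> y), z\<rangle>"
    by (simp add: polar_diff polar_distribs)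
qed

text \<open>The cubic form of the determinant is cyclic; the right factors are its gradients, which
  reappear as off-diagonal entries of the cross product.\<close>

lemma polar_mult_unit: "\<langle>(a \<cdot> b) \<cdot> c, \<e>\<rangle> = \<langle>a, \<kappa> (b \<cdot> c)\<rangle>" "\<langle>(a \<cdot> b) \<cdot> c, \<e>\<rangle> = \<langle>b, \<kappa> (c \<cdot> a)\<rangle>"
  "\<langle>(a \<cdot> b) \<cdot> c, \<e>\<rangle> = \<langle>c, \<kappa> (a \<cdot> b)\<rangle>"
  by (simp_all add: polar_conj_right conj_mult unit_left unit_right)
    (metis polar_conj_left polar_conj_right polar_commute)+

section \<open>The Albert algebra\<close>

sublocale W: vector_space "wsc Oc"
proof
  fix r s and x y :: "('k, 'o) albert"
  show "wsc Oc r (x + y) = wsc Oc r x + wsc Oc r y"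
    by (cases x; cases y) (simp add: O.scale_right_distrib distrib_left)
  show "wsc Oc (r + s) x = wsc Oc r x + wsc Oc s x"
    by (cases x) (simp add: O.scale_left_distrib distrib_right)
  show "wsc Oc r (wsc Oc s x) = wsc Oc (r * s) x"
    by (cases x) (simp add: mult.assoc)
  show "wsc Oc 1 x = x"
    by (cases x) simp
qed

lemma half_add_half: "1/2 + 1/2 = (1::'k)"
  using two by (metis add_divide_distrib one_add_one divide_self)

lemma six: "(6::'k) \<noteq> 0"
proof -
  have "(6::'k) = 2 * 3" by simp
  then show ?thesis using two three by (metis mult_eq_0_iff)
qed

abbreviation scale_W (infixr "*\<^sub>W" 75) where "scale_W \<equiv> wsc Oc"
abbreviation \<D> where "\<D> a b c \<equiv> \<langle>(a \<cdot> b) \<cdot> c, \<e>\<rangle>"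

subsection \<open>The trilinear form\<close>

text \<open>The full polarisation of \<open>albert_det\<close> divided by 6. Terms with a norm need
  only three summands, since the polar form already accounts for two permutations.\<close>

fun trilin_explicit :: "('k, 'o) albert \<Rightarrow> ('k, 'o) albert \<Rightarrow> ('k, 'o) albert \<Rightarrow> 'k" where
  "trilin_explicit (x1, x2, x3, a, b, c) (y1, y2, y3, a', b', c') (z1, z2, z3, a'', b'', c'') =
     inverse 6 * (x1 * (y2 * z3 + y3 * z2) + x2 * (y1 * z3 + y3 * z1) + x3 * (y1 * z2 + y2 * z1)
       - (x1 * \<langle>a', a''\<rangle> + y1 * \<langle>a, a''\<rangle> + z1 * \<langle>a, a'\<rangle>)
       - (x2 * \<langle>b', b''\<rangle> + y2 * \<langle>b, b''\<rangle> + z2 * \<langle>b, b'\<rangle>)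
       - (x3 * \<langle>c', c''\<rangle> + y3 * \<langle>c, c''\<rangle> + z3 * \<langle>c, c'\<rangle>)
       + \<D> a b' c'' + \<D> a b'' c' + \<D> a' b c'' + \<D> a' b'' c + \<D> a'' b c' + \<D> a'' b' c)"

lemma is_det_trilinear_explicit: "is_det_trilinear Oc trilin_explicit"
  unfolding is_det_trilinear_def Vector_Spaces.linear_iff
proof (intro conjI allI)
  show "vector_space (wsc Oc)"
    by (rule W.vector_space_axioms)
  show "vector_space ((*) :: 'k \<Rightarrow> _)"
    by unfold_locales (simp_all add: algebra_simps)
  fix x y z w :: "('k, 'o) albert" and r
  show "trilin_explicit (x + w) y z = trilin_explicit x y z + trilin_explicit w y z"
    by (cases x; cases y; cases z; cases w) (simp add: mult_distribs polar_distribs algebra_simps)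
  show "trilin_explicit (r *\<^sub>W x) y z = r * trilin_explicit x y z"
    by (cases x; cases y; cases z) (simp add: mult_distribs polar_distribs algebra_simps)
  show "trilin_explicit x y z = trilin_explicit y x z"
    by (cases x; cases y; cases z) (simp add: polar_commute algebra_simps)
  show "trilin_explicit x y z = trilin_explicit x z y"
    by (cases x; cases y; cases z) (simp add: polar_commute algebra_simps)
  show "trilin_explicit x x x = albert_det Oc x"
  proof (cases x)
    case (fields x1 x2 x3 a b c)
    have "6 * trilin_explicit x x x = 6 * albert_det Oc x"
      using six by (simp add: fields polar_self algebra_simps)
    then show ?thesis
      using six by simp
  qed
qed

text \<open>Inclusion-exclusion. As 6 is invertible, this yields uniqueness of the trilinear form
  and, later, its invariance under the stabiliser.\<close>

lemma det_trilinear_polarization: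
  assumes "is_det_trilinear Oc T"
  shows "6 * T x y z = albert_det Oc (x + y + z) - albert_det Oc (x + y) - albert_det Oc (x + z)
    - albert_det Oc (y + z) + albert_det Oc x + albert_det Oc y + albert_det Oc z"
proof -
  have comm: "T x y z = T y x z" "T x y z = T x z y" for x y z
    using assms unfolding is_det_trilinear_def by blast+
  have add: "T (x + x') y z = T x y z + T x' y z" for x x' y z
    using assms unfolding is_det_trilinear_def Vector_Spaces.linear_iff by blast
  have add': "T y (x + x') z = T y x z + T y x' z" "T y z (x + x') = T y z x + T y z x'" for x x' y z
    using add comm by metis+
  have det: "albert_det Oc x = T x x x" for x
    using assms unfolding is_det_trilinear_def by metis
  show ?thesis
    unfolding det add add' by (simp add: comm)
qed

lemma trilin_eq_explicit: "trilin Oc = trilin_explicit"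
  unfolding trilin_def
proof (rule the_equality, rule is_det_trilinear_explicit, intro ext)
  fix T x y z
  assume "is_det_trilinear Oc T"
  then have "6 * T x y z = 6 * trilin_explicit x y z"
    using is_det_trilinear_explicit by (simp only: det_trilinear_polarization)
  then show "T x y z = trilin_explicit x y z"
    using six by simp
qed

lemma is_det_trilinear_trilin: "is_det_trilinear Oc (trilin Oc)"
  by (simp add: trilin_eq_explicit is_det_trilinear_explicit)

lemmas trilin_polarization = det_trilinear_polarization[OF is_det_trilinear_trilin]

lemma trilin_commute: "trilin Oc x y z = trilin Oc y x z" "trilin Oc x y z = trilin Oc x z y"
  using is_det_trilinear_trilin unfolding is_det_trilinear_def by blast+

lemma trilin_self: "trilin Oc x x x = albert_det Oc x"
  using is_det_trilinear_trilin unfolding is_det_trilinear_def by blast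

lemma trilin_distribs1: "trilin Oc (x + x') y z = trilin Oc x y z + trilin Oc x' y z"
  "trilin Oc (r *\<^sub>W x) y z = r * trilin Oc x y z"
  using is_det_trilinear_trilin unfolding is_det_trilinear_def Vector_Spaces.linear_iff by blast+

subsection \<open>The trace form\<close>

fun trace_form_explicit :: "('k, 'o) albert \<Rightarrow> ('k, 'o) albert \<Rightarrow> 'k" where
  "trace_form_explicit (x1, x2, x3, a, b, c) (y1, y2, y3, a', b', c') =
     x1 * y1 + x2 * y2 + x3 * y3 + \<langle>a, a'\<rangle> + \<langle>b, b'\<rangle> + \<langle>c, c'\<rangle>"

lemma albert_matrix_inject:
  assumes "\<forall>i j. albert_matrix Oc x $ i $ j = albert_matrix Oc y $ i $ j"
  shows "x = y"
  using assms by (cases x; cases y) (simp add: forall_3 vector_3)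

lemma jordan_explicit: "jordan Oc (x1, x2, x3, a, b, c) (y1, y2, y3, a', b', c') =
   (x1 * y1 + 1/2 * (\<langle>c, c'\<rangle> + \<langle>b, b'\<rangle>), x2 * y2 + 1/2 * (\<langle>c, c'\<rangle> + \<langle>a, a'\<rangle>),
    x3 * y3 + 1/2 * (\<langle>b, b'\<rangle> + \<langle>a, a'\<rangle>),
    (1/2) *\<^sub>O ((x2 + x3) *\<^sub>O a' + (y2 + y3) *\<^sub>O a + \<kappa> (b \<cdot> c') + \<kappa> (b' \<cdot> c)),
    (1/2) *\<^sub>O ((x1 + x3) *\<^sub>O b' + (y1 + y3) *\<^sub>O b + \<kappa> (c \<cdot> a') + \<kappa> (c' \<cdot> a)),
    (1/2) *\<^sub>O ((x1 + x2) *\<^sub>O c' + (y1 + y2) *\<^sub>O c + \<kappa> (a \<cdot> b') + \<kappa> (a' \<cdot> b)))"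
  (is "jordan Oc ?x ?y = ?z")
  unfolding jordan_def
proof (rule the_equality)
  \<comment> \<open>The two matrix products each contribute half of a diagonal product, so the
    expected entry is split accordingly.\<close>
  have half: "r *\<^sub>O \<e> = (r/2) *\<^sub>O \<e> + (r/2) *\<^sub>O \<e>" for r
    using half_add_half by (metis O.scale_left_distrib add_divide_distrib distrib_left mult.right_neutral times_divide_eq_right)
  \<comment> \<open>On the diagonal, octonion products occur in conjugate pairs; eliminating one
    member of each leaves a scalar times the unit.\<close>
  have sw: "\<kappa> a' \<cdot> a = \<langle>a, a'\<rangle> *\<^sub>O \<e> - \<kappa> a \<cdot> a'" "a' \<cdot> \<kappa> a = \<langle>a, a'\<rangle> *\<^sub>O \<e> - a \<cdot> \<kappa> a'"
    "\<kappa> b' \<cdot> b = \<langle>b, b'\<rangle> *\<^sub>O \<e> - \<kappa> b \<cdot> b'" "b' \<cdot> \<kappa> b = \<langle>b, b'\<rangle> *\<^sub>O \<e> - b \<cdot> \<kappa> b'"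
    "\<kappa> c' \<cdot> c = \<langle>c, c'\<rangle> *\<^sub>O \<e> - \<kappa> c \<cdot> c'" "c' \<cdot> \<kappa> c = \<langle>c, c'\<rangle> *\<^sub>O \<e> - c \<cdot> \<kappa> c'"
    by (simp_all add: eq_diff_eq conj_mult_polarized polar_commute)
  let ?XY = "omatrix_mult Oc (albert_matrix Oc ?x) (albert_matrix Oc ?y)
       + omatrix_mult Oc (albert_matrix Oc ?y) (albert_matrix Oc ?x)"
  show *: "\<forall>i j. albert_matrix Oc ?z $ i $ j = osc Oc (1/2) (?XY $ i $ j)"
    using two
    by (simp add: forall_3 vector_3 sum_3 omatrix_mult_def mult_distribs unit_left unit_right
        conj_distribs conj_mult sw O.scale_right_distrib O.scale_left_distrib
        O.scale_right_diff_distrib half[of "x1 * y1"] half[of "x2 * y2"] half[of "x3 * y3"]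
        add_divide_distrib mult.commute add_ac)
  show "z = ?z" if "\<forall>i j. albert_matrix Oc z $ i $ j = osc Oc (1/2) (?XY $ i $ j)" for z
    using * that by (intro albert_matrix_inject) simp
qed

lemma trace_form_eq_explicit: "trace_form Oc x y = trace_form_explicit x y"
proof -
  \<comment> \<open>Each off-diagonal pairing occurs in two diagonal entries of the Jordan product
    with weight 1/2.\<close>
  have "h * (p + q) + h * (p + r) + h * (q + r) = p + q + r" if "h + h = 1" for h p q r :: 'k
    using that by algebra
  from this[OF half_add_half] show ?thesis
    by (cases x; cases y) (simp add: trace_form_def jordan_explicit two algebra_simps)
qed

subsection \<open>The cross product\<close>

text \<open>Freudenthal's product, the polarisation of the quadratic adjoint
  \<open>x \<mapsto> x \<times> x\<close> given in \<open>cross_self\<close>.\<close>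

fun cross_explicit :: "('k, 'o) albert \<Rightarrow> ('k, 'o) albert \<Rightarrow> ('k, 'o) albert" where
  "cross_explicit (x1, x2, x3, a, b, c) (y1, y2, y3, a', b', c') = (1/2) *\<^sub>W
     (x2 * y3 + x3 * y2 - \<langle>a, a'\<rangle>, x1 * y3 + x3 * y1 - \<langle>b, b'\<rangle>, x1 * y2 + x2 * y1 - \<langle>c, c'\<rangle>,
      \<kappa> (b \<cdot> c') + \<kappa> (b' \<cdot> c) - x1 *\<^sub>O a' - y1 *\<^sub>O a,
      \<kappa> (c \<cdot> a') + \<kappa> (c' \<cdot> a) - x2 *\<^sub>O b' - y2 *\<^sub>O b,
      \<kappa> (a \<cdot> b') + \<kappa> (a' \<cdot> b) - x3 *\<^sub>O c' - y3 *\<^sub>O c)"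

section \<open>Bilinearity and nondegeneracy of the trace form\<close>

lemma trace_form_commute: "trace_form Oc x y = trace_form Oc y x"
  by (cases x; cases y) (simp add: trace_form_eq_explicit polar_commute algebra_simps)

lemma trace_form_distribs:
  "trace_form Oc (x + y) z = trace_form Oc x z + trace_form Oc y z"
  "trace_form Oc z (x + y) = trace_form Oc z x + trace_form Oc z y"
  "trace_form Oc (r *\<^sub>W x) z = r * trace_form Oc x z"
  "trace_form Oc z (r *\<^sub>W x) = r * trace_form Oc z x"
  by (cases x; cases y; cases z; simp add: trace_form_eq_explicit polar_distribs algebra_simps)+

lemma trace_form_minus [simp]:
  "trace_form Oc (- x) z = - trace_form Oc x z" "trace_form Oc z (- x) = - trace_form Oc z x"
  by (cases x; cases z; simp add: trace_form_eq_explicit algebra_simps)+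

lemma trace_form_diff:
  "trace_form Oc (x - y) z = trace_form Oc x z - trace_form Oc y z"
  "trace_form Oc z (x - y) = trace_form Oc z x - trace_form Oc z y"
  using trace_form_distribs(1)[of x "- y" z] trace_form_distribs(2)[of z x "- y"] by simp_all

lemma trace_form_zero [simp]: "trace_form Oc 0 z = 0" "trace_form Oc z 0 = 0"
  using trace_form_distribs(3)[of 0 0 z] trace_form_distribs(4)[of z 0 0] by simp_all

lemma trace_form_nondegenerate:
  assumes "\<And>z. trace_form Oc x z = 0"
  shows "x = 0"
proof (cases x)
  case (fields x1 x2 x3 a b c)
  have "a = 0" "b = 0" "c = 0"
    using assms[of "(0, 0, 0, z, 0, 0)" for z] assms[of "(0, 0, 0, 0, z, 0)" for z]
      assms[of "(0, 0, 0, 0, 0, z)" for z]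
    by (auto simp: fields trace_form_eq_explicit intro: nondegenerate)
  then show ?thesis
    using assms[of "(1, 0, 0, 0, 0, 0)"] assms[of "(0, 1, 0, 0, 0, 0)"] assms[of "(0, 0, 1, 0, 0, 0)"]
    by (simp add: fields trace_form_eq_explicit zero_prod_def)
qed

lemma eq_by_trace_form: "(\<And>z. trace_form Oc x z = trace_form Oc y z) \<Longrightarrow> x = y"
  using trace_form_nondegenerate[of "x - y"] by (simp add: trace_form_diff)

lemma trace_form_cross_explicit: "trace_form Oc (cross_explicit x y) z = 3 * trilin Oc x y z"
proof (cases x; cases y; cases z)
  fix x1 x2 x3 a b c y1 y2 y3 a' b' c' z1 z2 z3 a'' b'' c''
  assume *: "x = (x1, x2, x3, a, b, c)" "y = (y1, y2, y3, a', b', c')" "z = (z1, z2, z3, a'', b'', c'')"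
  have 3: "3 * (inverse 6 * r) = 1/2 * (r::'k)" for r
  proof -
    have "inverse (6::'k) = inverse 2 * inverse 3"
      by (simp flip: inverse_mult_distrib)
    then have "3 * inverse 6 = (1/2 :: 'k)"
      by (simp only: mult.left_commute[of 3] right_inverse[OF three] mult_1_right inverse_eq_divide[of 2])
    then show ?thesis by (simp only: mult.assoc[symmetric])
  qed
  \<comment> \<open>Cyclicity isolates the entry belonging to \<open>z\<close>, so that both sides
    become linear in it.\<close>
  have D: "\<D> a b' c'' = \<langle>c'', \<kappa> (a \<cdot> b')\<rangle>" "\<D> a' b c'' = \<langle>c'', \<kappa> (a' \<cdot> b)\<rangle>"
    "\<D> a b'' c' = \<langle>b'', \<kappa> (c' \<cdot> a)\<rangle>" "\<D> a' b'' c = \<langle>b'', \<kappa> (c \<cdot> a')\<rangle>"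
    "\<D> a'' b c' = \<langle>a'', \<kappa> (b \<cdot> c')\<rangle>" "\<D> a'' b' c = \<langle>a'', \<kappa> (b' \<cdot> c)\<rangle>"
    by (rule polar_mult_unit)+
  show ?thesis
    unfolding * cross_explicit.simps trace_form_distribs trilin_eq_explicit trilin_explicit.simps 3 D
    by (rule arg_cong[where f = "\<lambda>r. 1/2 * r"])
      (simp add: trace_form_eq_explicit polar_distribs polar_diff polar_commute algebra_simps)
qed

lemma cross_eq_explicit: "cross Oc = cross_explicit"
proof (intro ext)
  fix x y
  show "cross Oc x y = cross_explicit x y"
    unfolding cross_def
  proof (rule the_equality)
    show "\<forall>z. 3 * trilin Oc x y z = trace_form Oc (cross_explicit x y) z"
      by (simp add: trace_form_cross_explicit)
    show "u = cross_explicit x y" if "\<forall>z. 3 * trilin Oc x y z = trace_form Oc u z" for u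
      by (rule eq_by_trace_form) (metis that trace_form_cross_explicit)
  qed
qed

lemma trace_form_cross: "trace_form Oc (cross Oc x y) z = 3 * trilin Oc x y z"
  by (simp add: cross_eq_explicit trace_form_cross_explicit)

lemma cross_commute: "cross Oc x y = cross Oc y x"
  by (rule eq_by_trace_form) (simp add: trace_form_cross trilin_commute(1)[of x])

lemma cross_distribs:
  "cross Oc (x + y) z = cross Oc x z + cross Oc y z"
  "cross Oc z (x + y) = cross Oc z x + cross Oc z y"
  "cross Oc (r *\<^sub>W x) z = r *\<^sub>W cross Oc x z"
  "cross Oc z (r *\<^sub>W x) = r *\<^sub>W cross Oc z x"
proof -
  show *: "cross Oc (x + y) z = cross Oc x z + cross Oc y z" "cross Oc (r *\<^sub>W x) z = r *\<^sub>W cross Oc x z"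
    for x y z
    by (rule eq_by_trace_form, simp add: trace_form_cross trace_form_distribs trilin_distribs1 algebra_simps)+
  show "cross Oc z (x + y) = cross Oc z x + cross Oc z y" "cross Oc z (r *\<^sub>W x) = r *\<^sub>W cross Oc z x"
    by (simp_all add: cross_commute[of z] *)
qed

section \<open>The adjoint identity\<close>

lemma cross_self: "cross Oc (x1, x2, x3, a, b, c) (x1, x2, x3, a, b, c) =
  (x2 * x3 - \<N> a, x1 * x3 - \<N> b, x1 * x2 - \<N> c,
   \<kappa> (b \<cdot> c) - x1 *\<^sub>O a, \<kappa> (c \<cdot> a) - x2 *\<^sub>O b, \<kappa> (a \<cdot> b) - x3 *\<^sub>O c)"
proof -
  have k: "1/2 * (p + p - 2 * n) = p - n" for p n :: 'k
    using half_add_half two by (simp add: right_diff_distrib distrib_left distrib_right[symmetric])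
  have o: "(1/2) *\<^sub>O (p + p - q - q) = p - q" for p q
  proof -
    have "(1/2) *\<^sub>O (p + p - q - q) = (1/2 + 1/2) *\<^sub>O (p - q)"
      by (simp only: O.scale_left_distrib O.scale_right_distrib O.scale_right_diff_distrib) simp
    then show ?thesis
      by (simp only: half_add_half O.scale_one)
  qed
  show ?thesis
    using k[of "x2 * x3" "\<N> a"] k[of "x1 * x3" "\<N> b"] k[of "x1 * x2" "\<N> c"]
    unfolding cross_eq_explicit cross_explicit.simps wsc.simps polar_self o
    by (simp only: mult.commute[of x3 x2] mult.commute[of x3 x1] mult.commute[of x2 x1])
qed

text \<open>The octonion product in an off-diagonal entry of the twofold adjoint. The product of two
  conjugated products is handled by \<open>moufang\<close>, the mixed terms by cancellation of
  conjugates.\<close>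

lemma adjoint_off_diagonal:
  "\<kappa> ((\<kappa> (c \<cdot> a) - s *\<^sub>O b) \<cdot> (\<kappa> (a \<cdot> b) - t *\<^sub>O c))
     = (\<langle>\<kappa> (b \<cdot> c), a\<rangle> - s * \<N> b - t * \<N> c) *\<^sub>O a + (s * t - \<N> a) *\<^sub>O \<kappa> (b \<cdot> c)"
proof -
  have 1: "\<kappa> (\<kappa> (c \<cdot> a) \<cdot> \<kappa> (a \<cdot> b)) = \<langle>\<kappa> (b \<cdot> c), a\<rangle> *\<^sub>O a - \<N> a *\<^sub>O \<kappa> (b \<cdot> c)"
    using conj_mult[of "\<kappa> (c \<cdot> a)" "\<kappa> (a \<cdot> b)"] by (simp only: conj_conj moufang)
  have 2: "\<kappa> (\<kappa> (c \<cdot> a) \<cdot> c) = \<N> c *\<^sub>O a"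
    using conj_mult[of "\<kappa> (c \<cdot> a)" c] by (simp only: conj_conj conj_cancel_left)
  have 3: "\<kappa> (b \<cdot> \<kappa> (a \<cdot> b)) = \<N> b *\<^sub>O a"
    using conj_mult[of b "\<kappa> (a \<cdot> b)"] by (simp only: conj_conj conj_cancel_right)
  show ?thesis
    by (simp add: mult_diff mult_distribs conj_distribs 1 2 3 O.scale_left_distrib
        O.scale_left_diff_distrib algebra_simps)
qed

lemma adjoint_diagonal:
  "\<N> (\<kappa> (b \<cdot> c) - r *\<^sub>O a) = \<N> b * \<N> c + r\<^sup>2 * \<N> a - r * \<langle>\<kappa> (b \<cdot> c), a\<rangle>"
  by (simp add: norm_diff multiplicative nrm_scale polar_distribs)

text \<open>In each off-diagonal entry the multiples of the conjugated product cancel and the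
  determinant is left as coefficient; by cyclic symmetry one computation serves all three
  positions.\<close>

lemma adjoint_identity: "cross Oc (cross Oc x x) (cross Oc x x) = albert_det Oc x *\<^sub>W x"
proof (cases x)
  case (fields x1 x2 x3 a b c)
  let ?D = "\<langle>\<kappa> (b \<cdot> c), a\<rangle>"
  have D: "\<D> a b c = ?D" "\<langle>\<kappa> (c \<cdot> a), b\<rangle> = ?D" "\<langle>\<kappa> (a \<cdot> b), c\<rangle> = ?D"
    using polar_mult_unit[of a b c] by (simp_all add: polar_commute)
  show ?thesis
    unfolding fields cross_self adjoint_off_diagonal adjoint_diagonal albert_det.simps wsc.simps D
    by (simp add: O.scale_left_distrib O.scale_left_diff_distrib O.scale_right_diff_distrib
        algebra_simps power2_eq_square)
qed

abbreviation unit_W ("\<e>\<^sub>W") where "\<e>\<^sub>W \<equiv> (1, 1, 1, 0, 0, 0)"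

lemma cross_unit: "cross Oc \<e>\<^sub>W x = (1/2) *\<^sub>W (trace_form Oc \<e>\<^sub>W x *\<^sub>W \<e>\<^sub>W - x)"
  by (cases x) (simp add: cross_eq_explicit trace_form_eq_explicit conj_distribs algebra_simps)

section \<open>Operators on the Albert algebra\<close>

lemma sum_tuple: "(\<Sum>i\<in>I. (f1 i :: 'k, f2 i :: 'k, f3 i :: 'k, a i :: 'o, b i :: 'o, c i :: 'o))
  = (sum f1 I, sum f2 I, sum f3 I, sum a I, sum b I, sum c I)"
  by (induction I rule: infinite_finite_induct) (simp_all add: zero_prod_def)

subsection \<open>Dual bases and the trace\<close>

text \<open>The very choice made inside \<open>endo_trace\<close>, so that the trace becomes a sum
  over a fixed basis.\<close>

definition basis_W :: "('k, 'o) albert set" where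
  "basis_W = (SOME B. \<not> module.dependent (wsc Oc) B \<and> module.span (wsc Oc) B = UNIV)"

lemma basis_O_exists: "\<exists>B. finite B \<and> O.independent B \<and> O.span B = UNIV \<and> card B = 8"
proof -
  obtain B where B: "B \<subseteq> UNIV" "O.independent B" "UNIV \<subseteq> O.span B" "card B = O.dim (UNIV :: 'o set)"
    using O.basis_exists[of UNIV] by blast
  moreover from B(4) have "card B = 8" by (simp add: dim_8)
  moreover from this have "finite B" by (metis card.infinite zero_neq_numeral)
  ultimately show ?thesis by blast
qed

text \<open>Finiteness of the chosen basis comes from comparing it with an explicit finite spanning
  set: the diagonal idempotents and three copies of an octonion basis.\<close>

lemma basis_W: "finite basis_W" "W.independent basis_W" "W.span basis_W = UNIV"
proof -
  obtain B where "W.independent B" "UNIV \<subseteq> W.span B"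
    by (rule W.basis_exists[of UNIV])
  then have "\<exists>B. W.independent B \<and> W.span B = UNIV"
    by (intro exI[of _ B]) auto
  then have "W.independent basis_W \<and> W.span basis_W = UNIV"
    unfolding basis_W_def by (rule someI_ex)
  then show ind: "W.independent basis_W" and "W.span basis_W = UNIV"
    by blast+
  obtain BO where BO: "finite BO" "O.span BO = UNIV"
    using basis_O_exists by blast
  define S :: "('k, 'o) albert set" where "S = {(1,0,0,0,0,0), (0,1,0,0,0,0), (0,0,1,0,0,0)}
    \<union> (\<lambda>x. (0,0,0,x,0,0)) ` BO \<union> (\<lambda>x. (0,0,0,0,x,0)) ` BO \<union> (\<lambda>x. (0,0,0,0,0,x)) ` BO"
  have O_span: "f x \<in> W.span S"
    if f: "\<And>x y. f (x + y) = f x + f y" "\<And>r x. f (r *\<^sub>O x) = r *\<^sub>W f x" "f ` BO \<subseteq> S" for f x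
  proof -
    have "x \<in> O.span BO"
      by (simp add: BO)
    then show ?thesis
    proof (induction rule: O.span_induct_alt)
      case base
      then show ?case using f(2)[of 0 0] W.span_zero by simp
    next
      case (step r x y)
      then show ?case
        using f(3) by (auto simp: f(1,2) intro!: W.span_add W.span_scale intro: W.span_base)
    qed
  qed
  have abc: "(0,0,0,x,0,0) \<in> W.span S" "(0,0,0,0,x,0) \<in> W.span S" "(0,0,0,0,0,x) \<in> W.span S" for x
    using O_span[of "\<lambda>x. (0,0,0,x,0,0)" x] O_span[of "\<lambda>x. (0,0,0,0,x,0)" x]
      O_span[of "\<lambda>x. (0,0,0,0,0,x)" x]
    by (auto simp: S_def)
  have "v \<in> W.span S" for v
  proof (cases v)
    case (fields v1 v2 v3 x y z)
    have "v = wsc Oc v1 (1,0,0,0,0,0) + wsc Oc v2 (0,1,0,0,0,0) + wsc Oc v3 (0,0,1,0,0,0)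
      + (0,0,0,x,0,0) + (0,0,0,0,y,0) + (0,0,0,0,0,z)"
      by (simp add: fields)
    also have "\<dots> \<in> W.span S"
      by (intro W.span_add W.span_scale abc) (auto simp: S_def intro!: W.span_base)
    finally show ?thesis .
  qed
  then have "basis_W \<subseteq> W.span S"
    by blast
  moreover have "finite S"
    using BO by (simp add: S_def)
  ultimately show "finite basis_W"
    using W.independent_span_bound[OF _ ind, of S] by blast
qed

definition dual_W :: "('k, 'o) albert \<Rightarrow> ('k, 'o) albert" where
  "dual_W = (SOME d. \<forall>b\<in>basis_W. \<forall>v. trace_form Oc (d b) v = W.representation basis_W v b)"

lemma trace_form_dual: "b \<in> basis_W \<Longrightarrow> trace_form Oc (dual_W b) v = W.representation basis_W v b"
  using someI_ex[OF W.dual_basis_exists[OF basis_W, of "trace_form Oc"]]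
    trace_form_distribs trace_form_nondegenerate
  unfolding dual_W_def by blast

lemma trace_form_sum: "trace_form Oc (\<Sum>i\<in>I. f i) z = (\<Sum>i\<in>I. trace_form Oc (f i) z)"
  "trace_form Oc z (\<Sum>i\<in>I. f i) = (\<Sum>i\<in>I. trace_form Oc z (f i))"
  by (induction I rule: infinite_finite_induct) (simp_all add: trace_form_distribs)

lemma sum_dual: "(\<Sum>b\<in>basis_W. trace_form Oc (dual_W b) v *\<^sub>W b) = v"
    "(\<Sum>b\<in>basis_W. trace_form Oc v b *\<^sub>W dual_W b) = v"
proof -
  show 1: "(\<Sum>b\<in>basis_W. trace_form Oc (dual_W b) v *\<^sub>W b) = v" for v
    using basis_W by (simp add: trace_form_dual W.sum_representation_eq)
  show "(\<Sum>b\<in>basis_W. trace_form Oc v b *\<^sub>W dual_W b) = v"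
  proof (rule eq_by_trace_form)
    fix z
    have "trace_form Oc (\<Sum>b\<in>basis_W. trace_form Oc v b *\<^sub>W dual_W b) z
      = trace_form Oc v (\<Sum>b\<in>basis_W. trace_form Oc (dual_W b) z *\<^sub>W b)"
      by (simp add: trace_form_sum trace_form_distribs mult.commute)
    then show "trace_form Oc (\<Sum>b\<in>basis_W. trace_form Oc v b *\<^sub>W dual_W b) z = trace_form Oc v z"
      by (simp add: 1)
  qed
qed

abbreviation trace_E ("tr") where "trace_E \<equiv> endo_trace (wsc Oc)"

lemma trace_eq: "tr A = (\<Sum>b\<in>basis_W. trace_form Oc (dual_W b) (A b))"
  by (simp add: endo_trace_def basis_W_def[symmetric] Let_def trace_form_dual)

lemma sum_trace_form_dual: "(\<Sum>b\<in>basis_W. trace_form Oc (dual_W b) v * trace_form Oc p b) = trace_form Oc p v"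
proof -
  have "trace_form Oc p (\<Sum>b\<in>basis_W. trace_form Oc (dual_W b) v *\<^sub>W b) = trace_form Oc p v"
    by (simp only: sum_dual)
  then show ?thesis
    by (simp add: trace_form_sum trace_form_distribs)
qed

subsection \<open>Rank one operators\<close>

sublocale E: vector_space "esc Oc"
  by unfold_locales (auto simp: esc_def W.scale_right_distrib W.scale_left_distrib)

lemma trace_distribs: "tr (A + B) = tr A + tr B" "tr (esc Oc r A) = r * tr A"
    "tr (A - B) = tr A - tr B"
  by (simp_all add: trace_eq esc_def trace_form_distribs trace_form_diff sum.distrib sum_subtractf sum_distrib_left)

definition rank_one :: "('k, 'o) albert \<Rightarrow> ('k, 'o) albert \<Rightarrow> ('k, 'o) albert_endo" where
  "rank_one p a = (\<lambda>w. trace_form Oc p w *\<^sub>W a)"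

lemma trace_rank_one: "tr (rank_one p a) = trace_form Oc p a"
  by (simp add: trace_eq rank_one_def trace_form_distribs mult.commute[of "trace_form Oc p _"] sum_trace_form_dual)

section \<open>Symmetry and linearity of triple operators\<close>

lemma trilin_eq_cross: "trilin Oc x y z = 1/3 * trace_form Oc (cross Oc x y) z"
  using three by (simp add: trace_form_cross)

lemma trilin_rotate: "trilin Oc x y z = trilin Oc z x y"
  by (simp only: trilin_commute(2)[of x y z] trilin_commute(1)[of x z y])

lemma triple_op_eq: "triple_op Oc x y z
    = esc Oc (1/3) (rank_one (cross Oc x y) z + rank_one (cross Oc y z) x + rank_one (cross Oc z x) y)"
proof
  fix w
  have "trilin Oc w u v = 1/3 * trace_form Oc (cross Oc u v) w" for u v
    using trilin_rotate[of u v w] trilin_eq_cross[of u v w] by simp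
  then show "triple_op Oc x y z w = esc Oc (1/3) (rank_one (cross Oc x y) z + rank_one (cross Oc y z) x + rank_one (cross Oc z x) y) w"
    by (simp only: triple_op_def esc_def rank_one_def plus_fun_apply W.scale_right_distrib W.scale_scale)
qed

lemma triple_op_commute: "triple_op Oc x y z = triple_op Oc y x z" "triple_op Oc x y z = triple_op Oc x z y"
  unfolding triple_op_def trilin_commute(2)[of _ y x] trilin_commute(2)[of _ z x] trilin_commute(2)[of _ z y]
  by (simp_all add: add_ac)

lemma trilin_distribs2:
  "trilin Oc y (x + x') z = trilin Oc y x z + trilin Oc y x' z"
  "trilin Oc y (r *\<^sub>W x) z = r * trilin Oc y x z"
  by (simp_all only: trilin_distribs1 trilin_commute(1)[of y])

lemma trilin_distribs3:
  "trilin Oc y z (x + x') = trilin Oc y z x + trilin Oc y z x'"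
  "trilin Oc y z (r *\<^sub>W x) = r * trilin Oc y z x"
  by (simp_all only: trilin_distribs1 trilin_rotate[of y z])

lemmas trilin_distribs = trilin_distribs1 trilin_distribs2 trilin_distribs3

lemma triple_op_rotate: "triple_op Oc x y z = triple_op Oc z x y"
  by (simp only: triple_op_commute(2)[of x y z] triple_op_commute(1)[of x z y])

lemma triple_op_distribs1:
  "triple_op Oc (x + x') y z = triple_op Oc x y z + triple_op Oc x' y z"
  "triple_op Oc (r *\<^sub>W x) y z = esc Oc r (triple_op Oc x y z)"
  by (rule ext, simp add: triple_op_def esc_def trilin_distribs W.scale_left_distrib
      W.scale_right_distrib mult.commute add_ac)+

lemma triple_op_distribs2:
  "triple_op Oc y (x + x') z = triple_op Oc y x z + triple_op Oc y x' z"
  "triple_op Oc y (r *\<^sub>W x) z = esc Oc r (triple_op Oc y x z)"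
  by (simp_all only: triple_op_distribs1 triple_op_commute(1)[of y])

lemma triple_op_distribs3:
  "triple_op Oc y z (x + x') = triple_op Oc y z x + triple_op Oc y z x'"
  "triple_op Oc y z (r *\<^sub>W x) = esc Oc r (triple_op Oc y z x)"
  by (simp_all only: triple_op_distribs1 triple_op_rotate[of y z])

lemmas triple_op_distribs = triple_op_distribs1 triple_op_distribs2 triple_op_distribs3

lemma triple_op_zero: "triple_op Oc 0 y z = 0" "triple_op Oc y 0 z = 0" "triple_op Oc y z 0 = 0"
  using triple_op_distribs(2)[of 0 0 y z] triple_op_distribs2(2)[of y 0 0 z] triple_op_distribs3(2)[of y z 0 0]
  by simp_all

lemma triple_op_sum:
  "triple_op Oc (\<Sum>i\<in>I. f i) y z = (\<Sum>i\<in>I. triple_op Oc (f i) y z)"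
  by (induction I rule: infinite_finite_induct) (simp_all add: triple_op_distribs triple_op_zero)

lemma triple_op_self: "triple_op Oc x x x = rank_one (cross Oc x x) x"
proof
  fix w
  have "trilin Oc w x x = 1/3 * trace_form Oc (cross Oc x x) w"
    using trilin_rotate[of x x w] trilin_eq_cross[of x x w] by simp
  moreover have "1/3 * r + 1/3 * r + 1/3 * r = r" for r :: 'k
    using three by (simp add: field_simps)
  ultimately show "triple_op Oc x x x w = rank_one (cross Oc x x) x w"
    by (simp only: triple_op_def rank_one_def W.scale_left_distrib[symmetric])
qed

lemma trace_triple_op: "tr (triple_op Oc x y z) = 3 * trilin Oc x y z"
proof -
  have "tr (triple_op Oc x y z) = trilin Oc x y z + trilin Oc y z x + trilin Oc z x y"
    by (simp only: triple_op_eq trace_distribs trace_rank_one trilin_eq_cross distrib_left)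
  then show ?thesis
    by (simp only: trilin_rotate[of y z x] trilin_rotate[of x y z, symmetric]) simp
qed

subsection \<open>The bilinear maps behind the product\<close>

text \<open>Every \<open>A\<close> is the sum of \<open>rank_one (dual_W b) (A b)\<close> over the
  basis. Defining the map on all operators in this way makes independence of the presentation by
  triples automatic.\<close>

definition Phi :: "('k, 'o) albert_endo \<Rightarrow> ('k, 'o) albert_endo \<Rightarrow> ('k, 'o) albert_endo" where
  "Phi A B = (\<Sum>b\<in>basis_W. \<Sum>c\<in>basis_W. triple_op Oc (cross Oc (dual_W b) (dual_W c)) (A b) (B c))"

text \<open>This is the trace of the composite of \<open>A\<close> and \<open>B\<close>, written in
  coordinates.\<close>

definition pairing :: "('k, 'o) albert_endo \<Rightarrow> ('k, 'o) albert_endo \<Rightarrow> 'k" where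
  "pairing A B = (\<Sum>b\<in>basis_W. \<Sum>c\<in>basis_W.
     trace_form Oc (dual_W b) (A c) * trace_form Oc (dual_W c) (B b))"

lemma Phi_distribs:
  "Phi (A + B) C = Phi A C + Phi B C" "Phi C (A + B) = Phi C A + Phi C B"
  "Phi (esc Oc r A) C = esc Oc r (Phi A C)" "Phi C (esc Oc r A) = esc Oc r (Phi C A)"
  by (simp_all add: Phi_def triple_op_distribs sum.distrib E.scale_sum_right esc_def[of Oc r A])

lemma pairing_distribs:
  "pairing (A + B) C = pairing A C + pairing B C" "pairing C (A + B) = pairing C A + pairing C B"
  "pairing (esc Oc r A) C = r * pairing A C" "pairing C (esc Oc r A) = r * pairing C A"
  by (simp_all add: pairing_def esc_def trace_form_distribs sum.distrib sum_distrib_left algebra_simps)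

lemma Phi_commute: "Phi A B = Phi B A"
  unfolding Phi_def
  by (subst sum.swap, intro sum.cong refl, subst cross_commute, rule triple_op_commute(2))

lemma pairing_commute: "pairing A B = pairing B A"
  unfolding pairing_def by (subst sum.swap) (simp add: mult.commute)

lemma cross_sum: "cross Oc (\<Sum>i\<in>I. f i) z = (\<Sum>i\<in>I. cross Oc (f i) z)"
  "cross Oc z (\<Sum>i\<in>I. f i) = (\<Sum>i\<in>I. cross Oc z (f i))"
  using cross_distribs(3)[of 0 0 z] cross_distribs(4)[of z 0 0]
  by (induction I rule: infinite_finite_induct) (simp_all add: cross_distribs)

lemma Phi_rank_one: "Phi (rank_one p a) (rank_one q b) = triple_op Oc (cross Oc p q) a b"
proof -
  have "triple_op Oc (cross Oc p q) a b = triple_op Oc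
      (cross Oc (\<Sum>b\<in>basis_W. trace_form Oc p b *\<^sub>W dual_W b) (\<Sum>c\<in>basis_W. trace_form Oc q c *\<^sub>W dual_W c)) a b"
    by (simp only: sum_dual)
  also have "\<dots> = Phi (rank_one p a) (rank_one q b)"
    by (simp add: Phi_def rank_one_def cross_sum cross_distribs triple_op_sum triple_op_distribs
        E.scale_sum_right mult.commute) (rule sum.swap)
  finally show ?thesis by simp
qed

lemma pairing_rank_one: "pairing (rank_one p a) (rank_one q b) = trace_form Oc p b * trace_form Oc q a"
proof -
  have "pairing (rank_one p a) (rank_one q b)
      = (\<Sum>d\<in>basis_W. trace_form Oc (dual_W d) a * trace_form Oc q d) *
        (\<Sum>c\<in>basis_W. trace_form Oc (dual_W c) b * trace_form Oc p c)"
    by (simp add: pairing_def rank_one_def trace_form_distribs sum_product ac_simps)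
      (subst sum.swap, simp only: ac_simps)
  then show ?thesis
    by (simp add: sum_trace_form_dual)
qed

lemma third: "1/3 * (3 * r) = (r::'k)"
  using three by simp

text \<open>These nine terms represent the 36 summands of the form \<open>f'\<close>, which fall
  into classes of four equal ones.\<close>

lemma pairing_triple_op: "pairing (triple_op Oc x y z) (triple_op Oc x' y' z')
   = trilin Oc x y z' * trilin Oc x' y' z + trilin Oc x y x' * trilin Oc y' z' z + trilin Oc x y y' * trilin Oc z' x' z
   + (trilin Oc y z z' * trilin Oc x' y' x + trilin Oc y z x' * trilin Oc y' z' x + trilin Oc y z y' * trilin Oc z' x' x)
   + (trilin Oc z x z' * trilin Oc x' y' y + trilin Oc z x x' * trilin Oc y' z' y + trilin Oc z x y' * trilin Oc z' x' y)"
proof -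
  have "pairing (triple_op Oc x y z) (triple_op Oc x' y' z') = 1/3 * (3 * (1/3 * (3 *
   (trilin Oc x y z' * trilin Oc x' y' z + trilin Oc x y x' * trilin Oc y' z' z + trilin Oc x y y' * trilin Oc z' x' z
   + (trilin Oc y z z' * trilin Oc x' y' x + trilin Oc y z x' * trilin Oc y' z' x + trilin Oc y z y' * trilin Oc z' x' x)
   + (trilin Oc z x z' * trilin Oc x' y' y + trilin Oc z x x' * trilin Oc y' z' y + trilin Oc z x y' * trilin Oc z' x' y)))))"
    unfolding triple_op_eq pairing_distribs pairing_rank_one trace_form_cross
    by (simp only: ring_distribs ac_simps)
  then show ?thesis
    by (simp only: third)
qed

text \<open>Each triple operator carries a factor 1/3, so 36 becomes 4. The shape
  \<open>s + s + (s + s)\<close> matches the doubling in both permutation sums.\<close>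

lemma Phi_triple_op: "esc Oc 36 (Phi (triple_op Oc x y z) (triple_op Oc x' y' z')) =
  (let s = triple_op Oc (cross Oc (cross Oc x y) (cross Oc x' y')) z z'
    + triple_op Oc (cross Oc (cross Oc x y) (cross Oc y' z')) z x'
    + triple_op Oc (cross Oc (cross Oc x y) (cross Oc z' x')) z y'
    + (triple_op Oc (cross Oc (cross Oc y z) (cross Oc x' y')) x z'
    + triple_op Oc (cross Oc (cross Oc y z) (cross Oc y' z')) x x'
    + triple_op Oc (cross Oc (cross Oc y z) (cross Oc z' x')) x y')
    + (triple_op Oc (cross Oc (cross Oc z x) (cross Oc x' y')) y z'
    + triple_op Oc (cross Oc (cross Oc z x) (cross Oc y' z')) y x'
    + triple_op Oc (cross Oc (cross Oc z x) (cross Oc z' x')) y y') in s + s + (s + s))"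
proof -
  let ?s = "triple_op Oc (cross Oc (cross Oc x y) (cross Oc x' y')) z z'
    + triple_op Oc (cross Oc (cross Oc x y) (cross Oc y' z')) z x'
    + triple_op Oc (cross Oc (cross Oc x y) (cross Oc z' x')) z y'
    + (triple_op Oc (cross Oc (cross Oc y z) (cross Oc x' y')) x z'
    + triple_op Oc (cross Oc (cross Oc y z) (cross Oc y' z')) x x'
    + triple_op Oc (cross Oc (cross Oc y z) (cross Oc z' x')) x y')
    + (triple_op Oc (cross Oc (cross Oc z x) (cross Oc x' y')) y z'
    + triple_op Oc (cross Oc (cross Oc z x) (cross Oc y' z')) y x'
    + triple_op Oc (cross Oc (cross Oc z x) (cross Oc z' x')) y y')"
  have "(9::'k) = 3 * 3" by simp
  then have "(9::'k) \<noteq> 0" using three by (metis mult_eq_0_iff)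
  then have 4: "36 * (1/3 * (1/3)) = (4::'k)"
    using three by simp
  have *: "esc Oc 4 s = s + s + (s + s)" for s
    using E.scale_left_distrib[of 2 2 s] E.scale_left_distrib[of 1 1 s] by simp
  have "Phi (triple_op Oc x y z) (triple_op Oc x' y' z') = esc Oc (1/3) (esc Oc (1/3) ?s)"
    unfolding triple_op_eq[of x] triple_op_eq[of x'] Phi_distribs Phi_rank_one
    by (simp only: E.scale_right_distrib add_ac)
  then show ?thesis
    by (simp only: Let_def E.scale_scale 4 *)
qed

section \<open>Expansions along a line \<open>x + t y\<close>\<close>

lemma cross_line: "cross Oc (x + t *\<^sub>W y) (x + t *\<^sub>W y)
    = cross Oc x x + t *\<^sub>W cross Oc x y + t *\<^sub>W cross Oc x y + (t * t) *\<^sub>W cross Oc y y"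
  by (simp add: cross_distribs cross_commute[of y x] W.scale_right_distrib add_ac)

text \<open>Stated for an abstract form \<open>F\<close> because it is used both to linearise the
  adjoint identity and to study the contragredient.\<close>

lemma quartic_line:
  assumes add: "\<And>x y z. F (x + y) z = F x z + F y z" "\<And>x y z. F z (x + y) = F z x + F z y"
    and scale: "\<And>r x z. F (r *\<^sub>W x) z = r * F x z" "\<And>r x z. F z (r *\<^sub>W x) = r * F z x"
    and sym: "\<And>x y. F x y = F y x"
  shows "F (cross Oc (x + t *\<^sub>W y) (x + t *\<^sub>W y)) (cross Oc (x + t *\<^sub>W y) (x + t *\<^sub>W y))
    = F (cross Oc x x) (cross Oc x x) + t * (4 * F (cross Oc x x) (cross Oc x y))
      + t^2 * (4 * F (cross Oc x y) (cross Oc x y) + 2 * F (cross Oc x x) (cross Oc y y))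
      + t^3 * (4 * F (cross Oc x y) (cross Oc y y)) + t^4 * F (cross Oc y y) (cross Oc y y)"
  unfolding cross_line add scale sym[of "cross Oc x y" "cross Oc x x"]
    sym[of "cross Oc y y" "cross Oc x x"] sym[of "cross Oc y y" "cross Oc x y"]
  by (simp add: algebra_simps power2_eq_square power3_eq_cube power4_eq_xxxx)

lemma det_line: "albert_det Oc (x + t *\<^sub>W y) = albert_det Oc x + t * (3 * trilin Oc x x y)
    + t^2 * (3 * trilin Oc x y y) + t^3 * albert_det Oc y"
proof -
  have "trilin Oc x y x = trilin Oc x x y" "trilin Oc y x x = trilin Oc x x y"
    "trilin Oc y x y = trilin Oc x y y" "trilin Oc y y x = trilin Oc x y y"
    by (metis trilin_commute)+
  then show ?thesis
    unfolding trilin_self[symmetric] trilin_distribs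
    by (simp add: algebra_simps power2_eq_square power3_eq_cube)
qed

lemma adjoint_linearized:
  "4 * trace_form Oc (cross Oc (cross Oc x x) (cross Oc x y)) z
     = albert_det Oc x * trace_form Oc y z + trace_form Oc (cross Oc x x) y * trace_form Oc x z"
proof -
  let ?F = "\<lambda>p q. trace_form Oc (cross Oc p q) z"
  let ?X = "trace_form Oc x z" and ?Y = "trace_form Oc y z"
  \<comment> \<open>Each bracket is the difference of the coefficients of a power of
    \<open>t\<close> in the adjoint identity on the line, paired with \<open>z\<close>; the linear
    one is the claim.\<close>
  have "(?F (cross Oc x x) (cross Oc x x) - albert_det Oc x * ?X)
    + t * (4 * ?F (cross Oc x x) (cross Oc x y) - (albert_det Oc x * ?Y + 3 * trilin Oc x x y * ?X))
    + t^2 * (4 * ?F (cross Oc x y) (cross Oc x y) + 2 * ?F (cross Oc x x) (cross Oc y y)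
        - (3 * trilin Oc x x y * ?Y + 3 * trilin Oc x y y * ?X))
    + t^3 * (4 * ?F (cross Oc x y) (cross Oc y y) - (3 * trilin Oc x y y * ?Y + albert_det Oc y * ?X))
    + t^4 * (?F (cross Oc y y) (cross Oc y y) - albert_det Oc y * ?Y) = 0" (is "?L = 0") for t
  proof -
    have "?F (cross Oc (x + t *\<^sub>W y) (x + t *\<^sub>W y)) (cross Oc (x + t *\<^sub>W y) (x + t *\<^sub>W y))
      = albert_det Oc (x + t *\<^sub>W y) * (?X + t * ?Y)"
      by (simp add: adjoint_identity trace_form_distribs)
    then have "(?F (cross Oc x x) (cross Oc x x) + t * (4 * ?F (cross Oc x x) (cross Oc x y))
      + t^2 * (4 * ?F (cross Oc x y) (cross Oc x y) + 2 * ?F (cross Oc x x) (cross Oc y y))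
      + t^3 * (4 * ?F (cross Oc x y) (cross Oc y y)) + t^4 * ?F (cross Oc y y) (cross Oc y y))
     - (albert_det Oc x + t * (3 * trilin Oc x x y)
       + t^2 * (3 * trilin Oc x y y) + t^3 * albert_det Oc y) * (?X + t * ?Y) = 0"
      by (subst (asm) quartic_line[where F = ?F])
        (simp_all only: det_line cross_distribs trace_form_distribs cross_commute right_minus_eq)
    then show ?thesis
      by (simp add: algebra_simps power2_eq_square power3_eq_cube power4_eq_xxxx)
  qed
  from quartic_coefficients(1)[OF two three this] show ?thesis
    by (simp add: trace_form_cross[of x x y])
qed

subsection \<open>Reduction to cubes\<close>

lemma sigma_A_eq: "sigma_A Oc = E.span (range (\<lambda>x. triple_op Oc x x x))"
proof
  show "E.span (range (\<lambda>x. triple_op Oc x x x)) \<subseteq> sigma_A Oc"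
    unfolding sigma_A_def by (rule E.span_mono) blast
  let ?C = "E.span (range (\<lambda>x. triple_op Oc x x x))"
  have cube: "triple_op Oc x x x \<in> ?C" for x
    by (rule E.span_base) simp
  have "triple_op Oc x y z \<in> ?C" for x y z
  proof -
    let ?t = "triple_op Oc x y z"
    let ?s = "triple_op Oc (x + y + z) (x + y + z) (x + y + z) - triple_op Oc (x + y) (x + y) (x + y)
      - triple_op Oc (x + z) (x + z) (x + z) - triple_op Oc (y + z) (y + z) (y + z)
      + triple_op Oc x x x + triple_op Oc y y y + triple_op Oc z z z"
    have "?s = ?t + ?t + ?t + (?t + ?t + ?t)"
      unfolding triple_op_distribs by (simp add: triple_op_commute)
    also have "\<dots> = esc Oc 6 ?t"
      using E.scale_left_distrib[of 3 3 ?t] E.scale_left_distrib[of 2 1 ?t] E.scale_left_distrib[of 1 1 ?t]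
      by simp
    finally have "?t = esc Oc (inverse 6) ?s"
      using six by simp
    also have "\<dots> \<in> ?C"
      by (intro E.span_scale E.span_add E.span_diff cube)
    finally show ?thesis .
  qed
  then show "sigma_A Oc \<subseteq> ?C"
    unfolding sigma_A_def by (intro E.span_minimal E.subspace_span) auto
qed

lemma triple_op_in_sigma_A: "triple_op Oc x y z \<in> sigma_A Oc"
  unfolding sigma_A_def by (rule E.span_base) blast

lemma sigma_A_closed: "A \<in> sigma_A Oc \<Longrightarrow> B \<in> sigma_A Oc \<Longrightarrow> A + B \<in> sigma_A Oc"
  "A \<in> sigma_A Oc \<Longrightarrow> B \<in> sigma_A Oc \<Longrightarrow> A - B \<in> sigma_A Oc"
  "A \<in> sigma_A Oc \<Longrightarrow> esc Oc r A \<in> sigma_A Oc" "0 \<in> sigma_A Oc"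
  unfolding sigma_A_def by (simp_all add: E.span_add E.span_diff E.span_scale E.span_zero)

text \<open>Membership is carried along because the laws in \<open>bilinear_on\<close> are available
  only inside \<open>sigma_A\<close>.\<close>

lemma sigma_A_induct [consumes 1, case_names cube add scale]:
  assumes "A \<in> sigma_A Oc"
    and "\<And>x. Q (triple_op Oc x x x)"
    and "\<And>A B. A \<in> sigma_A Oc \<Longrightarrow> B \<in> sigma_A Oc \<Longrightarrow> Q A \<Longrightarrow> Q B \<Longrightarrow> Q (A + B)"
    and "\<And>r A. A \<in> sigma_A Oc \<Longrightarrow> Q A \<Longrightarrow> Q (esc Oc r A)"
  shows "Q A"
proof -
  have "A \<in> sigma_A Oc \<and> Q A"
    using assms(1) unfolding sigma_A_eq
  proof (induction rule: E.span_induct_alt)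
    case base
    \<comment> \<open>Zero is treated as a zero multiple of a cube, which spares a separate
      case.\<close>
    have "Q (esc Oc 0 (triple_op Oc 0 0 0))"
      by (intro assms triple_op_in_sigma_A)
    then have "Q 0"
      by (simp only: E.scale_zero_left)
    then show ?case
      using E.span_zero by blast
  next
    case (step r x y)
    then have "x \<in> sigma_A Oc" "Q x" "y \<in> sigma_A Oc" "Q y"
      using assms(2) triple_op_in_sigma_A by (auto simp: sigma_A_eq)
    then show ?case
      unfolding sigma_A_eq[symmetric] by (intro conjI sigma_A_closed assms(3,4))
  qed
  then show ?thesis ..
qed

text \<open>Two nested inductions reduce any bilinear identity on \<open>sigma_A\<close> to rank one
  operators.\<close>

lemma bilinear_on_sigma_A_eq:
  assumes "A \<in> sigma_A Oc" "B \<in> sigma_A Oc"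
    and P: "bilinear_on (esc Oc) s (sigma_A Oc) P" and Q: "bilinear_on (esc Oc) s (sigma_A Oc) Q"
    and eq: "\<And>x y. P (triple_op Oc x x x) (triple_op Oc y y y) = Q (triple_op Oc x x x) (triple_op Oc y y y)"
  shows "P A B = Q A B"
  using assms(1)
proof (induction A rule: sigma_A_induct)
  case (cube x)
  show ?case
    using assms(2)
  proof (induction B rule: sigma_A_induct)
    case (cube y)
    then show ?case by (rule eq)
  next
    case (add B C)
    then show ?case
      using P Q triple_op_in_sigma_A[of x x x] unfolding bilinear_on_def by metis
  next
    case (scale r B)
    then show ?case
      using P Q triple_op_in_sigma_A[of x x x] unfolding bilinear_on_def by metis
  qed
next
  case (add A C)
  then show ?case
    using P Q assms(2) unfolding bilinear_on_def by metis
next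
  case (scale r A)
  then show ?case
    using P Q assms(2) unfolding bilinear_on_def by metis
qed

text \<open>For cubes with adjoints \<open>p\<close> and \<open>q\<close>, the trace is
  \<open>\<langle>x \<times> y, p \<times> q\<rangle>\<close>. Symmetry of the trilinear form moves
  this to \<open>\<langle>p \<times> (x \<times> y), q\<rangle>\<close>, where the linearised
  adjoint identity applies.\<close>

lemma trace_Phi:
  assumes "A \<in> sigma_A Oc" "B \<in> sigma_A Oc"
  shows "12 * tr (Phi A B) = tr A * tr B + 3 * pairing A B"
proof (rule bilinear_on_sigma_A_eq[OF assms])
  show "bilinear_on (esc Oc) (*) (sigma_A Oc) (\<lambda>A B. 12 * tr (Phi A B))"
    "bilinear_on (esc Oc) (*) (sigma_A Oc) (\<lambda>A B. tr A * tr B + 3 * pairing A B)"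
    by (simp_all add: bilinear_on_def Phi_distribs trace_distribs pairing_distribs algebra_simps)
  fix x y
  let ?p = "cross Oc x x" and ?q = "cross Oc y y"
  have "tr (triple_op Oc (cross Oc ?p ?q) x y) = trace_form Oc (cross Oc x y) (cross Oc ?p ?q)"
    by (simp add: trace_triple_op trace_form_cross trilin_rotate[of x y])
  also have "\<dots> = trace_form Oc (cross Oc ?p (cross Oc x y)) ?q"
    by (metis trace_form_commute trace_form_cross trilin_commute)
  finally have "tr (triple_op Oc (cross Oc ?p ?q) x y) = trace_form Oc (cross Oc ?p (cross Oc x y)) ?q" .
  \<comment> \<open>The extra factor 3 turns \<open>det(x)\<close> into
    \<open>\<langle>p, x\<rangle>\<close>, the trace of the cube of \<open>x\<close>.\<close>
  then have "3 * (4 * tr (triple_op Oc (cross Oc ?p ?q) x y))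
    = 3 * (albert_det Oc x * trace_form Oc y ?q + trace_form Oc ?p y * trace_form Oc x ?q)"
    by (simp only: adjoint_linearized)
  also have "\<dots> = trace_form Oc ?p x * trace_form Oc ?q y + 3 * (trace_form Oc ?p y * trace_form Oc ?q x)"
    by (simp add: trace_form_cross[of x x x] trilin_self trace_form_commute[of _ ?q] algebra_simps)
  finally have "12 * tr (triple_op Oc (cross Oc ?p ?q) x y)
    = trace_form Oc ?p x * trace_form Oc ?q y + 3 * (trace_form Oc ?p y * trace_form Oc ?q x)"
    by simp
  then show "12 * tr (Phi (triple_op Oc x x x) (triple_op Oc y y y))
    = tr (triple_op Oc x x x) * tr (triple_op Oc y y y) + 3 * pairing (triple_op Oc x x x) (triple_op Oc y y y)"
    by (simp add: triple_op_self Phi_rank_one pairing_rank_one trace_rank_one)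
qed

subsection \<open>The identity operator\<close>

lemma sum_operator_apply: "(\<Sum>i\<in>I. f i :: ('k, 'o) albert_endo) w = (\<Sum>i\<in>I. f i w)"
  by (induction I rule: infinite_finite_induct) auto

lemma trace_sum: "tr (\<Sum>i\<in>I. f i) = (\<Sum>i\<in>I. tr (f i))"
proof -
  have "tr 0 = 0"
    using trace_distribs(2)[of 0 0] by (simp only: E.scale_zero_left mult_zero_left)
  then show ?thesis
    by (induction I rule: infinite_finite_induct)
      (simp_all only: sum.infinite sum.empty sum.insert trace_distribs not_False_eq_True)
qed

lemma sigma_A_sum: "(\<And>i. i \<in> I \<Longrightarrow> f i \<in> sigma_A Oc) \<Longrightarrow> (\<Sum>i\<in>I. f i) \<in> sigma_A Oc"
  unfolding sigma_A_def by (rule E.span_sum)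

text \<open>
  The Peirce decomposition of \<open>W\<close> splits the identity: \<open>triple_op\<close> of the three diagonal
  idempotents is a multiple of the projection to the diagonal, and summing \<open>triple_op\<close> of an
  idempotent with dual bases of the opposite off-diagonal space gives a combination of two projections.
\<close>

lemma identity_in_sigma_A: "id \<in> sigma_A Oc" and trace_identity: "tr id = 27"
proof -
  obtain B where B: "finite B" "O.independent B" "O.span B = UNIV" "card B = 8"
    using basis_O_exists by blast
  obtain d where d: "\<And>b v. b \<in> B \<Longrightarrow> \<langle>d b, v\<rangle> = O.representation B v b"
    using O.dual_basis_exists[OF B(1-3), of "opolar Oc"] polar_distribs nondegenerate by metis
  have expand: "(\<Sum>b\<in>B. \<langle>v, d b\<rangle> *\<^sub>O b) = v" for v
    using B d by (simp add: polar_commute[of v] O.sum_representation_eq)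
  have expand': "(\<Sum>b\<in>B. \<langle>v, b\<rangle> *\<^sub>O d b) = v" for v
  proof (rule eq_by_polar)
    fix z
    have "\<langle>\<Sum>b\<in>B. \<langle>v, b\<rangle> *\<^sub>O d b, z\<rangle> = (\<Sum>b\<in>B. \<langle>z, d b\<rangle> * \<langle>b, v\<rangle>)"
      unfolding polar_sum polar_distribs
      by (intro sum.cong refl) (simp add: polar_commute[of v] polar_commute[of z] mult.commute)
    also have "\<dots> = \<langle>\<Sum>b\<in>B. \<langle>z, d b\<rangle> *\<^sub>O b, v\<rangle>"
      by (simp only: polar_sum polar_distribs)
    also have "\<dots> = \<langle>v, z\<rangle>"
      unfolding expand by (rule polar_commute)
    finally show "\<langle>\<Sum>b\<in>B. \<langle>v, b\<rangle> *\<^sub>O d b, z\<rangle> = \<langle>v, z\<rangle>" .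
  qed
  have dim: "(\<Sum>b\<in>B. \<langle>b, d b\<rangle>) = 8"
  proof -
    have "(\<Sum>b\<in>B. \<langle>b, d b\<rangle>) = (\<Sum>b\<in>B. 1)"
      using B d by (intro sum.cong) (simp_all add: polar_commute[of _ "d _"] O.representation_basis)
    then show ?thesis using B by simp
  qed
  let ?E1 = "(1,0,0,0,0,0) :: ('k, 'o) albert"
  let ?E2 = "(0,1,0,0,0,0) :: ('k, 'o) albert"
  let ?E3 = "(0,0,1,0,0,0) :: ('k, 'o) albert"
  define R1 where "R1 = (\<Sum>b\<in>B. triple_op Oc ?E1 (0,0,0,b,0,0) (0,0,0,d b,0,0))"
  define R2 where "R2 = (\<Sum>b\<in>B. triple_op Oc ?E2 (0,0,0,0,b,0) (0,0,0,0,d b,0))"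
  define R3 where "R3 = (\<Sum>b\<in>B. triple_op Oc ?E3 (0,0,0,0,0,b) (0,0,0,0,0,d b))"
  define D where "D = triple_op Oc ?E1 ?E2 ?E3"
  have sums: "(\<Sum>b\<in>B. inverse 6 * - (r * \<langle>b, d b\<rangle>)) = inverse 6 * - (r * 8)"
    "(\<Sum>b\<in>B. (inverse 6 * - \<langle>v, b\<rangle>) *\<^sub>O d b + (inverse 6 * - \<langle>v, d b\<rangle>) *\<^sub>O b) = (inverse 6 * - 2) *\<^sub>O v" for r v
  proof -
    show "(\<Sum>b\<in>B. inverse 6 * - (r * \<langle>b, d b\<rangle>)) = inverse 6 * - (r * 8)"
      by (simp only: sum_negf flip: sum_distrib_left) (simp only: dim)
    have "(\<Sum>b\<in>B. (inverse 6 * - \<langle>v, b\<rangle>) *\<^sub>O d b + (inverse 6 * - \<langle>v, d b\<rangle>) *\<^sub>O b)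
      = (\<Sum>b\<in>B. (inverse 6 * - 1) *\<^sub>O (\<langle>v, b\<rangle> *\<^sub>O d b) + (inverse 6 * - 1) *\<^sub>O (\<langle>v, d b\<rangle> *\<^sub>O b))"
      by simp
    also have "\<dots> = (inverse 6 * - 1) *\<^sub>O v + (inverse 6 * - 1) *\<^sub>O v"
      unfolding sum.distrib O.scale_sum_right[symmetric] expand expand' ..
    also have "\<dots> = (inverse 6 * - 2) *\<^sub>O v"
      by (simp only: O.scale_left_distrib[symmetric] distrib_left[symmetric]) simp
    finally show "(\<Sum>b\<in>B. (inverse 6 * - \<langle>v, b\<rangle>) *\<^sub>O d b + (inverse 6 * - \<langle>v, d b\<rangle>) *\<^sub>O b) = (inverse 6 * - 2) *\<^sub>O v" .
  qed
  have R1: "R1 (x1, x2, x3, a, b, c) = (inverse 6 * - (x1 * 8), 0, 0, (inverse 6 * - 2) *\<^sub>O a, 0, 0)" for x1 x2 x3 a b c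
    unfolding R1_def sum_operator_apply sums[symmetric]
    by (simp add: triple_op_def trilin_eq_explicit sum_tuple polar_commute)
  have R2: "R2 (x1, x2, x3, a, b, c) = (0, inverse 6 * - (x2 * 8), 0, 0, (inverse 6 * - 2) *\<^sub>O b, 0)" for x1 x2 x3 a b c
    unfolding R2_def sum_operator_apply sums[symmetric]
    by (simp add: triple_op_def trilin_eq_explicit sum_tuple polar_commute)
  have R3: "R3 (x1, x2, x3, a, b, c) = (0, 0, inverse 6 * - (x3 * 8), 0, 0, (inverse 6 * - 2) *\<^sub>O c)" for x1 x2 x3 a b c
    unfolding R3_def sum_operator_apply sums[symmetric]
    by (simp add: triple_op_def trilin_eq_explicit sum_tuple polar_commute)
  have D: "D (x1, x2, x3, a, b, c) = (inverse 6 * x1, inverse 6 * x2, inverse 6 * x3, 0, 0, 0)" for x1 x2 x3 a b c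
    by (simp add: D_def triple_op_def trilin_eq_explicit)
  have 6: "6 * inverse 6 = (1::'k)"
    using six by simp
  \<comment> \<open>Each \<open>R\<close> acts by -8/6 on its idempotent and by -2/6 on its octonion
    space, while \<open>D\<close> acts by 1/6 on the diagonal. The factor -3 gives 1 off the
    diagonal and 4 on it, and -18 corrects 4 to 1.\<close>
  have id: "id = esc Oc (- 3) (R1 + R2 + R3) + esc Oc (- 18) D"
  proof
    fix w :: "('k, 'o) albert"
    have "- 3 * (s * - (r * 8)) + - 18 * (s * r) = r" "- 3 * (s * - 2) = 1" if "6 * s = 1" for r s :: 'k
      using that by algebra+
    note coeffs = this[OF 6]
    show "id w = (esc Oc (- 3) (R1 + R2 + R3) + esc Oc (- 18) D) w"
    proof (cases w)
      case (fields x1 x2 x3 a b c)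
      then show ?thesis
        by (simp only: id_apply esc_def plus_fun_apply R1 R2 R3 D add_Pair wsc.simps O.scale_scale coeffs
            add_0_left add_0_right O.scale_one O.scale_zero_right mult_zero_right)
    qed
  qed
  show "id \<in> sigma_A Oc"
    unfolding id R1_def R2_def R3_def D_def
    by (intro sigma_A_closed sigma_A_sum triple_op_in_sigma_A)
  have trilin_values:
    "trilin Oc ?E1 (0,0,0,b,0,0) (0,0,0,d b,0,0) = inverse 6 * - (1 * \<langle>b, d b\<rangle>)"
    "trilin Oc ?E2 (0,0,0,0,b,0) (0,0,0,0,d b,0) = inverse 6 * - (1 * \<langle>b, d b\<rangle>)"
    "trilin Oc ?E3 (0,0,0,0,0,b) (0,0,0,0,0,d b) = inverse 6 * - (1 * \<langle>b, d b\<rangle>)"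
    "trilin Oc ?E1 ?E2 ?E3 = inverse 6" for b
    by (simp_all add: trilin_eq_explicit)
  have "tr R1 = 3 * (inverse 6 * - (1 * 8))" "tr R2 = 3 * (inverse 6 * - (1 * 8))"
    "tr R3 = 3 * (inverse 6 * - (1 * 8))" "tr D = 3 * inverse 6"
    unfolding R1_def R2_def R3_def D_def trace_sum trace_triple_op sum_distrib_left[symmetric] trilin_values
    by (simp_all only: sum_negf mult_1 dim)
  note traces = this
  \<comment> \<open>Each \<open>R\<close> has trace -4 and \<open>D\<close> has trace 1/2, giving 36
    - 9.\<close>
  have "tr id = - 3 * (3 * (inverse 6 * - (1 * 8)) + 3 * (inverse 6 * - (1 * 8)) + 3 * (inverse 6 * - (1 * 8)))
     + - 18 * (3 * inverse 6)"
    unfolding id trace_distribs traces ..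
  also have "- 3 * (3 * (s * - (1 * 8)) + 3 * (s * - (1 * 8)) + 3 * (s * - (1 * 8))) + - 18 * (3 * s) = 27"
    if "6 * s = 1" for s :: 'k
    using that by algebra
  note this[OF 6]
  finally show "tr id = 27" .
qed

subsection \<open>Equivariance\<close>

context
  fixes g
  assumes g: "g \<in> det_stabiliser Oc"
begin

lemma stabiliser_linear: "g (x + y) = g x + g y" "g (r *\<^sub>W x) = r *\<^sub>W g x"
  using g unfolding det_stabiliser_def Vector_Spaces.linear_iff by blast+

lemma stabiliser_bij: "bij g"
  using g by (simp add: det_stabiliser_def)

lemma stabiliser_det: "albert_det Oc (g x) = albert_det Oc x"
  using g unfolding det_stabiliser_def by blast

lemma stabiliser_inv: "g (inv g x) = x" "inv g (g x) = x"
  using stabiliser_bij by (simp_all add: bij_is_surj surj_f_inv_f bij_is_inj)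

lemma stabiliser_trilin: "trilin Oc (g x) (g y) (g z) = trilin Oc x y z"
proof -
  have "6 * trilin Oc (g x) (g y) (g z) = 6 * trilin Oc x y z"
    unfolding trilin_polarization stabiliser_linear(1)[symmetric] stabiliser_det ..
  then show ?thesis
    using six by simp
qed

text \<open>
  The contragredient \<open>h\<close> of \<open>g\<close> also preserves the determinant, so it intertwines the
  cross product with \<open>g\<close>. This is clear for arguments of the form \<open>x \<times> x\<close> by the adjoint
  identity; evaluating on the line through the unit in direction \<open>y\<close> and comparing
  coefficients gives it for all arguments.
\<close>

lemma contragredient_exists:
  obtains h where "\<And>p x. trace_form Oc (h p) (g x) = trace_form Oc p x"
    "\<And>x y. cross Oc (g x) (g y) = h (cross Oc x y)"
    "\<And>p q. cross Oc (h p) (h q) = g (cross Oc p q)"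
proof -
  have nondeg: "x = 0" if "\<And>y. trace_form Oc x (g y) = 0" for x
    by (rule trace_form_nondegenerate) (metis that stabiliser_inv(1))
  \<comment> \<open>A dual basis for the twisted form \<open>\<langle>x, g y\<rangle>\<close>
    constructs the contragredient directly.\<close>
  obtain d where d: "\<And>b v. b \<in> basis_W \<Longrightarrow> trace_form Oc (d b) (g v) = W.representation basis_W v b"
    using W.dual_basis_exists[OF basis_W, of "\<lambda>x y. trace_form Oc x (g y)"]
      trace_form_distribs stabiliser_linear nondeg by (metis (no_types, lifting))
  define h where "h p = (\<Sum>b\<in>basis_W. trace_form Oc p b *\<^sub>W d b)" for p
  have h: "trace_form Oc (h p) (g x) = trace_form Oc p x" for p x
  proof -
    have "trace_form Oc (h p) (g x) = (\<Sum>b\<in>basis_W. trace_form Oc (dual_W b) x * trace_form Oc p b)"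
      by (simp add: h_def trace_form_sum trace_form_distribs d trace_form_dual mult.commute)
    then show ?thesis
      by (simp only: sum_trace_form_dual)
  qed
  have eq: "x = y" if "\<And>z. trace_form Oc x (g z) = trace_form Oc y (g z)" for x y
    by (rule eq_by_trace_form) (metis that stabiliser_inv(1))
  have h_linear: "h (p + q) = h p + h q" "h (r *\<^sub>W p) = r *\<^sub>W h p" for p q r
    by (rule eq, simp add: h trace_form_distribs)+
  have cross_g: "cross Oc (g x) (g y) = h (cross Oc x y)" for x y
    by (rule eq) (simp add: h trace_form_cross stabiliser_trilin)
  have "cross Oc (h p) (h q) = g (cross Oc p q)" for p q
  proof (rule eq_by_trace_form)
    fix z
    define F where "F p q = trace_form Oc (cross Oc (h p) (h q)) z - trace_form Oc (g (cross Oc p q)) z" for p q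
    have F_add: "F (x + y) w = F x w + F y w" "F w (x + y) = F w x + F w y"
      and F_scale: "F (r *\<^sub>W x) w = r * F x w" "F w (r *\<^sub>W x) = r * F w x"
      and F_sym: "F x y = F y x" for x y w r
      by (simp_all add: F_def h_linear stabiliser_linear cross_distribs trace_form_distribs
          cross_commute[of "h x"] cross_commute[of x] algebra_simps)
    \<comment> \<open>Here \<open>h (x \<times> x)\<close> is the adjoint of \<open>g x\<close>, so
      both terms of the defect \<open>F\<close> equal \<open>det(x) g x\<close> paired with
      \<open>z\<close>.\<close>
    have F_adjoint: "F (cross Oc x x) (cross Oc x x) = 0" for x
      by (simp only: F_def cross_g[symmetric] adjoint_identity stabiliser_linear stabiliser_det diff_self)
    have unit: "cross Oc \<e>\<^sub>W \<e>\<^sub>W = \<e>\<^sub>W"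
      using two by (simp add: cross_self conj_distribs zero_prod_def)
    have line: "F \<e>\<^sub>W \<e>\<^sub>W + t * (4 * F \<e>\<^sub>W (cross Oc \<e>\<^sub>W y))
      + t^2 * (4 * F (cross Oc \<e>\<^sub>W y) (cross Oc \<e>\<^sub>W y) + 2 * F \<e>\<^sub>W (cross Oc y y))
      + t^3 * (4 * F (cross Oc \<e>\<^sub>W y) (cross Oc y y)) + t^4 * F (cross Oc y y) (cross Oc y y) = 0" for t y
      using quartic_line[of F "\<e>\<^sub>W" t y, OF F_add F_scale F_sym] F_adjoint[of "\<e>\<^sub>W + t *\<^sub>W y"]
      by (simp only: unit)
    have four: "(4::'k) \<noteq> 0"
    proof -
      have "(4::'k) = 2 * 2" by simp
      then show ?thesis using two by (metis mult_eq_0_iff)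
    qed
    \<comment> \<open>The witness solves \<open>\<e>\<^sub>W \<times> y = u\<close>: by
      \<open>cross_unit\<close> one needs
      \<open>y = \<langle>\<e>\<^sub>W, y\<rangle> \<e>\<^sub>W - 2 u\<close>, and pairing with the
      unit, of norm 3, forces \<open>\<langle>\<e>\<^sub>W, y\<rangle> = \<langle>\<e>\<^sub>W,
      u\<rangle>\<close>.\<close>
    have surj: "\<exists>y. cross Oc \<e>\<^sub>W y = u" for u
    proof
      have "trace_form Oc \<e>\<^sub>W \<e>\<^sub>W = 3"
        by (simp add: trace_form_eq_explicit)
      then have "trace_form Oc \<e>\<^sub>W (trace_form Oc \<e>\<^sub>W u *\<^sub>W \<e>\<^sub>W - 2 *\<^sub>W u) = trace_form Oc \<e>\<^sub>W u"
        by (simp only: trace_form_distribs trace_form_diff) simp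
      then show "cross Oc \<e>\<^sub>W (trace_form Oc \<e>\<^sub>W u *\<^sub>W \<e>\<^sub>W - 2 *\<^sub>W u) = u"
        using two by (simp only: cross_unit) (simp del: wsc.simps)
    qed
    have F_unit: "F \<e>\<^sub>W u = 0" for u
    proof -
      obtain y where "cross Oc \<e>\<^sub>W y = u" using surj by blast
      then show ?thesis
        using quartic_coefficients(1)[OF two three line[of _ y]] four by simp
    qed
    \<comment> \<open>Once \<open>F\<close> vanishes against the unit, the quadratic coefficient
      reduces to \<open>4 * F u u\<close>.\<close>
    have F_same: "F u u = 0" for u
    proof -
      obtain y where "cross Oc \<e>\<^sub>W y = u" using surj by blast
      then show ?thesis
        using quartic_coefficients(2)[OF two three line[of _ y]] four by (simp add: F_unit)
    qed
    have "2 * F p q = F (p + q) (p + q) - F p p - F q q"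
      by (simp add: F_add F_sym[of q p])
    also have "\<dots> = 0"
      by (simp only: F_same diff_self)
    finally have "2 * F p q = 0" .
    then show "trace_form Oc (cross Oc (h p) (h q)) z = trace_form Oc (g (cross Oc p q)) z"
      using two by (simp add: F_def)
  qed
  with that h cross_g show thesis by blast
qed

section \<open>Conjugation of operators by the stabiliser\<close>

lemma conjugate_distribs:
  "conjugate_by g (A + B) = conjugate_by g A + conjugate_by g B"
  "conjugate_by g (esc Oc r A) = esc Oc r (conjugate_by g A)"
  "conjugate_by g (A - B) = conjugate_by g A - conjugate_by g B"
  "conjugate_by g id = id"
proof -
  have "g (x - y) = g x - g y" for x y
    using stabiliser_linear(1)[of "x - y" y] by simp
  then show "conjugate_by g (A + B) = conjugate_by g A + conjugate_by g B"
    "conjugate_by g (esc Oc r A) = esc Oc r (conjugate_by g A)"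
    "conjugate_by g (A - B) = conjugate_by g A - conjugate_by g B"
    "conjugate_by g id = id"
    by (auto simp: fun_eq_iff conjugate_by_def esc_def stabiliser_linear stabiliser_inv simp del: split_paired_All)
qed

lemma conjugate_triple_op:
  "conjugate_by g (triple_op Oc x y z) = triple_op Oc (g x) (g y) (g z)"
proof
  fix w
  have "trilin Oc (inv g w) u v = trilin Oc w (g u) (g v)" for u v
    using stabiliser_trilin[of "inv g w" u v] by (simp only: stabiliser_inv)
  then show "conjugate_by g (triple_op Oc x y z) w = triple_op Oc (g x) (g y) (g z) w"
    by (simp add: conjugate_by_def triple_op_def stabiliser_linear)
qed

lemma conjugate_in_sigma_A: "A \<in> sigma_A Oc \<Longrightarrow> conjugate_by g A \<in> sigma_A Oc"
proof (induction A rule: sigma_A_induct)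
  case (cube x)
  show ?case
    unfolding conjugate_triple_op by (rule triple_op_in_sigma_A)
next
  case (add A B)
  show ?case
    unfolding conjugate_distribs by (intro sigma_A_closed add.IH)
next
  case (scale r A)
  show ?case
    unfolding conjugate_distribs by (intro sigma_A_closed scale.IH)
qed

lemma trace_conjugate: "A \<in> sigma_A Oc \<Longrightarrow> tr (conjugate_by g A) = tr A"
  by (induction A rule: sigma_A_induct)
    (simp_all only: conjugate_distribs conjugate_triple_op trace_distribs trace_triple_op stabiliser_trilin)

lemma pairing_conjugate:
  assumes "A \<in> sigma_A Oc" "B \<in> sigma_A Oc"
  shows "pairing (conjugate_by g A) (conjugate_by g B) = pairing A B"
proof (rule bilinear_on_sigma_A_eq[OF assms])
  show "bilinear_on (esc Oc) (*) (sigma_A Oc) (\<lambda>A B. pairing (conjugate_by g A) (conjugate_by g B))"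
    "bilinear_on (esc Oc) (*) (sigma_A Oc) pairing"
    by (simp_all only: bilinear_on_def conjugate_distribs pairing_distribs) blast+
  show "pairing (conjugate_by g (triple_op Oc x x x)) (conjugate_by g (triple_op Oc y y y))
      = pairing (triple_op Oc x x x) (triple_op Oc y y y)" for x y
    by (simp only: conjugate_triple_op pairing_triple_op stabiliser_trilin)
qed

text \<open>On cubes, the adjoints transform by the contragredient, and their cross product
  transforms again by \<open>g\<close>.\<close>

lemma Phi_conjugate:
  assumes "A \<in> sigma_A Oc" "B \<in> sigma_A Oc"
  shows "Phi (conjugate_by g A) (conjugate_by g B) = conjugate_by g (Phi A B)"
proof (rule bilinear_on_sigma_A_eq[OF assms])
  show "bilinear_on (esc Oc) (esc Oc) (sigma_A Oc) (\<lambda>A B. Phi (conjugate_by g A) (conjugate_by g B))"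
    "bilinear_on (esc Oc) (esc Oc) (sigma_A Oc) (\<lambda>A B. conjugate_by g (Phi A B))"
    by (simp_all only: bilinear_on_def conjugate_distribs Phi_distribs) blast+
  fix x y
  obtain h where "\<And>x y. cross Oc (g x) (g y) = h (cross Oc x y)"
    "\<And>p q. cross Oc (h p) (h q) = g (cross Oc p q)"
    using contragredient_exists by metis
  then show "Phi (conjugate_by g (triple_op Oc x x x)) (conjugate_by g (triple_op Oc y y y))
    = conjugate_by g (Phi (triple_op Oc x x x) (triple_op Oc y y y))"
    unfolding conjugate_triple_op unfolding triple_op_self Phi_rank_one conjugate_triple_op by simp
qed

end

subsection \<open>The product\<close>

lemma f'_formula:
  "(\<Sum>\<tau>a\<in>S3. \<Sum>\<tau>b\<in>S3. trilin Oc (a (\<tau>a 1)) (b (\<tau>b 2)) (b (\<tau>b 3)) * trilin Oc (b (\<tau>b 1)) (a (\<tau>a 2)) (a (\<tau>a 3)))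
    = 4 * pairing (triple_op3 Oc a) (triple_op3 Oc b)"
proof -
  let ?G = "\<lambda>i j k. trilin Oc (a i) (b 2) (b 3) * trilin Oc (b 1) (a j) (a k)
    + trilin Oc (a i) (b 3) (b 1) * trilin Oc (b 2) (a j) (a k)
    + trilin Oc (a i) (b 1) (b 2) * trilin Oc (b 3) (a j) (a k)"
  have inner: "(\<Sum>\<tau>b\<in>S3. trilin Oc (a i) (b (\<tau>b 2)) (b (\<tau>b 3)) * trilin Oc (b (\<tau>b 1)) (a j) (a k))
      = ?G i j k + ?G i j k" for i j k
    by (rule S3_sum_symmetric_23[of "\<lambda>l m n. trilin Oc (a i) (b m) (b n) * trilin Oc (b l) (a j) (a k)"])
      (simp only: trilin_commute(2)[of "a i"])
  have outer: "(\<Sum>\<tau>a\<in>S3. ?G (\<tau>a 1) (\<tau>a 2) (\<tau>a 3) + ?G (\<tau>a 1) (\<tau>a 2) (\<tau>a 3))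
      = (?G 1 2 3 + ?G 1 2 3 + (?G 2 3 1 + ?G 2 3 1) + (?G 3 1 2 + ?G 3 1 2))
       + (?G 1 2 3 + ?G 1 2 3 + (?G 2 3 1 + ?G 2 3 1) + (?G 3 1 2 + ?G 3 1 2))"
    by (rule S3_sum_symmetric_23[of "\<lambda>i j k. ?G i j k + ?G i j k"])
      (simp only: trilin_commute(2)[of "b _" "a _" "a _"])
  have rot: "trilin Oc (a i) (b j) (b k) = trilin Oc (b j) (b k) (a i)"
    "trilin Oc (b i) (a j) (a k) = trilin Oc (a j) (a k) (b i)" for i j k
    by (rule trilin_rotate[symmetric])+
  show ?thesis
    unfolding inner outer unfolding pairing_triple_op rot by (simp add: algebra_simps)
qed

lemma bilinear_pairing: "bilinear_on (esc Oc) (*) S (\<lambda>A B. 4 * pairing A B)"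
  by (simp add: bilinear_on_def pairing_distribs algebra_simps)

text \<open>The scaled pairing witnesses existence, so the chosen form satisfies its specification;
  only values on triple operators are extracted.\<close>

lemma f'_triple_op: "f' Oc (triple_op3 Oc a) (triple_op3 Oc b) = 4 * pairing (triple_op3 Oc a) (triple_op3 Oc b)"
proof -
  have "is_f' Oc (\<lambda>A B. 4 * pairing A B)"
    unfolding is_f'_def by (simp only: bilinear_pairing f'_formula) simp
  then have "is_f' Oc (f' Oc)"
    unfolding f'_def by (rule someI[of "is_f' Oc"])
  then show ?thesis
    unfolding is_f'_def by (simp only: f'_formula)
qed

text \<open>The 36 counts pairs of permutations, and 1/3 is 1/12 times the factor 4 relating
  \<open>f'\<close> to \<open>pairing\<close>.\<close>

definition odot :: "('k, 'o) albert_endo \<Rightarrow> ('k, 'o) albert_endo \<Rightarrow> ('k, 'o) albert_endo" where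
  "odot A B = esc Oc 36 (Phi A B) - esc Oc (1/3 * pairing A B) id"

lemma odot_formula:
  "(\<Sum>\<tau>a\<in>S3. \<Sum>\<tau>b\<in>S3.
     triple_op Oc (cross Oc (cross Oc (a (\<tau>a 1)) (a (\<tau>a 2))) (cross Oc (b (\<tau>b 1)) (b (\<tau>b 2)))) (a (\<tau>a 3)) (b (\<tau>b 3)))
   = esc Oc 36 (Phi (triple_op3 Oc a) (triple_op3 Oc b))"
proof -
  let ?t = "\<lambda>i j k l m n. triple_op Oc (cross Oc (cross Oc (a i) (a j)) (cross Oc (b l) (b m))) (a k) (b n)"
  let ?G = "\<lambda>i j k. ?t i j k 1 2 3 + ?t i j k 2 3 1 + ?t i j k 3 1 2"
  have inner: "(\<Sum>\<tau>b\<in>S3. ?t i j k (\<tau>b 1) (\<tau>b 2) (\<tau>b 3)) = ?G i j k + ?G i j k" for i j k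
    by (rule S3_sum_symmetric_12[of "?t i j k"]) (simp only: cross_commute[of "b _" "b _"])
  have outer: "(\<Sum>\<tau>a\<in>S3. ?G (\<tau>a 1) (\<tau>a 2) (\<tau>a 3) + ?G (\<tau>a 1) (\<tau>a 2) (\<tau>a 3))
      = (?G 1 2 3 + ?G 1 2 3 + (?G 2 3 1 + ?G 2 3 1) + (?G 3 1 2 + ?G 3 1 2))
       + (?G 1 2 3 + ?G 1 2 3 + (?G 2 3 1 + ?G 2 3 1) + (?G 3 1 2 + ?G 3 1 2))"
    by (rule S3_sum_symmetric_12[of "\<lambda>i j k. ?G i j k + ?G i j k"])
      (simp only: cross_commute[of "a _" "a _"])
  show ?thesis
    unfolding inner outer Phi_triple_op Let_def by (simp only: add_ac)
qed

lemma bilinear_odot: "bilinear_on (esc Oc) (esc Oc) S odot"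
  unfolding bilinear_on_def odot_def Phi_distribs pairing_distribs
  by (simp only: E.scale_right_distrib E.scale_left_distrib E.scale_right_diff_distrib distrib_left
      E.scale_scale mult.commute mult.left_commute add_diff_add) simp

lemma is_odot1_odot: "is_odot1 Oc odot"
proof -
  have "(3::'k) * 4 \<noteq> 0"
    using two three by (metis mult_2 mult_eq_0_iff numeral_Bit0)
  then have "1/12 * (4 * r) = 1/3 * r" for r :: 'k
    using three by (simp add: field_simps)
  then show ?thesis
    unfolding is_odot1_def
    by (simp only: bilinear_odot odot_formula f'_triple_op odot_def) simp
qed

lemma odot_unique:
  assumes "is_odot1 Oc Q" "A \<in> sigma_A Oc" "B \<in> sigma_A Oc"
  shows "Q A B = odot A B"
proof (rule bilinear_on_sigma_A_eq[OF assms(2,3)])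
  show "bilinear_on (esc Oc) (esc Oc) (sigma_A Oc) Q"
    using assms(1) unfolding is_odot1_def by blast
  show "bilinear_on (esc Oc) (esc Oc) (sigma_A Oc) odot"
    by (rule bilinear_odot)
  have "Q (triple_op3 Oc a) (triple_op3 Oc b) = odot (triple_op3 Oc a) (triple_op3 Oc b)" for a b
    using assms(1) is_odot1_odot unfolding is_odot1_def by simp
  \<comment> \<open>Cubes are the triples given by constant functions.\<close>
  from this[of "\<lambda>_. x" "\<lambda>_. y" for x y]
  show "Q (triple_op Oc x x x) (triple_op Oc y y y) = odot (triple_op Oc x x x) (triple_op Oc y y y)" for x y
    by simp
qed

section \<open>Closure, commutativity and equivariance of the product\<close>

lemma Phi_in_sigma_A:
  assumes "A \<in> sigma_A Oc" "B \<in> sigma_A Oc"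
  shows "Phi A B \<in> sigma_A Oc"
  using assms(1)
proof (induction A rule: sigma_A_induct)
  case (cube x)
  show ?case
    using assms(2)
  proof (induction B rule: sigma_A_induct)
    case (cube y)
    show ?case
      unfolding triple_op_self Phi_rank_one by (rule triple_op_in_sigma_A)
  qed (simp_all only: Phi_distribs sigma_A_closed)
qed (simp_all only: Phi_distribs sigma_A_closed)

text \<open>This explains the constant 1/12: for traceless arguments \<open>36 tr \<Phi>\<close>
  equals \<open>9 pairing\<close>, and the identity has trace 27, so subtracting a third of the
  pairing times the identity restores trace zero.\<close>

lemma odot_in_sigma_V:
  assumes "A \<in> sigma_V Oc" "B \<in> sigma_V Oc"
  shows "odot A B \<in> sigma_V Oc"
proof -
  have A: "A \<in> sigma_A Oc" "B \<in> sigma_A Oc" "tr A = 0" "tr B = 0"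
    using assms by (auto simp: sigma_V_def)
  have "tr (odot A B) = 3 * (12 * tr (Phi A B)) - 9 * (1/3 * (3 * pairing A B))"
    using third[of 27] by (simp add: odot_def trace_distribs trace_identity)
  also have "\<dots> = 0"
    using trace_Phi[OF A(1,2)] third[of "pairing A B"] by (simp add: A(3,4))
  finally have "tr (odot A B) = 0" .
  moreover have "odot A B \<in> sigma_A Oc"
    unfolding odot_def by (intro sigma_A_closed Phi_in_sigma_A A identity_in_sigma_A)
  ultimately show ?thesis
    by (simp add: sigma_V_def)
qed

lemma odot_commute: "odot A B = odot B A"
  unfolding odot_def Phi_commute[of A B] pairing_commute[of A B] ..

lemma odot_conjugate:
  assumes "g \<in> det_stabiliser Oc" "A \<in> sigma_A Oc" "B \<in> sigma_A Oc"
  shows "odot (conjugate_by g A) (conjugate_by g B) = conjugate_by g (odot A B)"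
  unfolding odot_def conjugate_distribs[OF assms(1)] Phi_conjugate[OF assms] pairing_conjugate[OF assms] ..

lemma conjugate_in_sigma_V:
  "g \<in> det_stabiliser Oc \<Longrightarrow> A \<in> sigma_V Oc \<Longrightarrow> conjugate_by g A \<in> sigma_V Oc"
  by (simp add: sigma_V_def conjugate_in_sigma_A trace_conjugate)

end

theorem proposition4p10:
  fixes Oc :: "('k::alg_closed_field, 'o::ab_group_add) octonion_structure"
  assumes "split_octonion_algebra Oc"
    and "CHAR('k) = 0 \<or> CHAR('k) \<ge> 14"
  shows "\<exists>P. is_odot1 Oc P
    \<and> (\<forall>Q. is_odot1 Oc Q \<longrightarrow> (\<forall>A\<in>sigma_A Oc. \<forall>B\<in>sigma_A Oc. Q A B = P A B))
    \<and> (\<forall>A\<in>sigma_V Oc. \<forall>B\<in>sigma_V Oc. P A B \<in> sigma_V Oc)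
    \<and> (\<forall>A\<in>sigma_V Oc. \<forall>B\<in>sigma_V Oc. P A B = P B A)
    \<and> (\<forall>g\<in>det_stabiliser Oc. \<forall>A\<in>sigma_V Oc. conjugate_by g A \<in> sigma_V Oc)
    \<and> (\<forall>g\<in>det_stabiliser Oc. \<forall>A\<in>sigma_V Oc. \<forall>B\<in>sigma_V Oc.
          P (conjugate_by g A) (conjugate_by g B) = conjugate_by g (P A B))"
proof -
  interpret split_octonion_algebra Oc by fact
  \<comment> \<open>A positive characteristic dividing \<open>n\<close> would be at most
    \<open>n\<close>, hence below 14.\<close>
  have "of_nat n \<noteq> (0::'k)" if "0 < n" "n < 14" for n
    using assms(2) that by (auto simp: of_nat_eq_0_iff_char_dvd dest: dvd_imp_le)
  from this[of 2] this[of 3] interpret octonions Oc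
    by unfold_locales simp_all
  show ?thesis
  proof (intro exI[of _ odot] conjI ballI allI impI)
    show "odot (conjugate_by g A) (conjugate_by g B) = conjugate_by g (odot A B)"
      if "g \<in> det_stabiliser Oc" "A \<in> sigma_V Oc" "B \<in> sigma_V Oc" for g A B
      using that by (intro odot_conjugate) (auto simp: sigma_V_def)
  qed (fact is_odot1_odot odot_unique odot_in_sigma_V conjugate_in_sigma_V | rule odot_commute)+
qed

end
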